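(* Let $n\ge 3$, let $\Lambda$ be a coherent $3\times n$ matching field, and let $M\in\mathbb{R}^{3\times n}$ be a weight matrix inducing $\Lambda$. If $\Lambda$ produces a toric degeneration of $\mathrm{Gr}(3,n)$, i.e. if the initial ideal $\mathrm{in}_{w_M}(\mathcal{I}_{3,n})$ of the Plücker ideal is prime and binomial, then $\Lambda$ is non-hexagonal.
   Context: Fix a field $\mathbb{K}$. Write $[n]=\{1,\dots,n\}$ and let $\mathbf{I}_{k,n}$ be the set of $k$-element subsets of $[n]$; here $k=3$. Plücker ideal: let $X=(x_{ij})$ be a $k\times n$ matrix of indeterminates and $X_I$ the submatrix with columns $I\in\mathbf{I}_{k,n}$. The Plücker ideal $\mathcal{I}_{k,n}\subset\mathbb{K}[P_I : I\in\mathbf{I}_{k,n}]$ is the kernel of $\mathbb{K}[P_I]\to\mathbb{K}[x_{ij}]$, $P_I\mapsto\det(X_I)$. The symbol $P_I$ is also used for the Plücker form $\det(X_I)$. Matching fields: a $k\times n$ matching field is a map $\Lambda:\mathbf{I}_{k,n}\to S_k$. For $I=\{i_1<\dots<i_k\}$ and $\sigma=\Lambda(I)$ put $\mathbf{x}_{\Lambda(I)}=x_{\sigma(1)i_1}x_{\sigma(2)i_2}\cdots x_{\sigma(k)i_k}$. A matrix $M=(a_{ij})\in\mathbb{R}^{k\times n}$ assigns weight $a_{ij}$ to $x_{ij}$; $\mathrm{in}_M(f)$ is the sum of all terms of $f$ of lowest weight. $\Lambda$ is coherent if there is $M$ with $\mathrm{in}_M(P_I)=\mathrm{sgn}(\Lambda(I))\,\mathbf{x}_{\Lambda(I)}$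 for all $I$; then $M$ induces $\Lambda$. The weight $w_M$ on the variables $P_I$ assigns to $P_I$ the $M$-weight of $\mathrm{in}_M(\det X_I)$, and $\mathrm{in}_{w_M}(\mathcal{I}_{k,n})$ is the ideal generated by the lowest-$w_M$-weight forms of the elements of $\mathcal{I}_{k,n}$. Tropical arrangements: every coherent matching field is induced by a matrix with first row zero. For $M=(a_{ij})\in\mathbb{R}^{3\times n}$ with first row zero, let $H_j\subset\mathbb{R}^2$ be the non-differentiability locus of $\max\{0,\,x_2-a_{2j},\,x_3-a_{3j}\}$, i.e. the tropical line with vertex $(a_{2j},a_{3j})$ and rays in directions $(1,1),(-1,0),(0,-1)$. Put $v_1=(1,1)$, $v_2=(-1,0)$, $v_3=(0,-1)$. For a $2$-dimensional cell $\tau$ (closure of a connected component of the complement of $\bigcup_j H_j$), its covector is $(S_1,S_2,S_3)$, where $S_i$ is the set of $j$ such that $H_j$ meets the ray $\{x+tv_i: t\ge 0\}$ for $x$ in the interior of $\tau$; its coarse covector is $(|S_1|,|S_2|,|S_3|)$. Hexagonal: a coherent $3\times 6$ matching field is hexagonal if it is induced by some matrix $M\in\mathbb{R}^{3\times 6}$ with zero first row whose arrangement $\{H_1,\dots,H_6\}$ is such that its unique cell with coarse covector $(2,2,2)$ is a hexagon (a polygon with exactly six edges). A $3\times n$ matching field $\Lambda$ is non-hexagonal if for every $6$-element subset $J\subset[n]$ the restriction $\Lambda|_J$ (the $3\times 6$ matching field obtained by restricting $\Lambda$ to $3$-subsets of $J$, with $J$ identified with $[6]$ order-preservingly) is not hexagonal.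 *)

theory Defs
  imports
    "HOL-Library.Poly_Mapping"
    "HOL-Combinatorics.Permutations"
    "HOL-Algebra.Ideal"
    "HOL-Algebra.RingHom"
    "HOL-Analysis.Polytope"
    "Jordan_Normal_Form.Determinant"
begin

section \<open>Multivariate polynomials\<close>

text \<open>A monomial is a finitely supported exponent function, a polynomial a finitely supported
  family of coefficients indexed by monomials. The type allows all of \<open>'v\<close> as variables;
  \<open>poly_ring V\<close> is the subring $\mathbb{K}[V]$.\<close>

type_synonym ('v, 'a) mpoly = "('v \<Rightarrow>\<^sub>0 nat) \<Rightarrow>\<^sub>0 'a"

definition Var :: "'v \<Rightarrow> ('v, 'a::comm_ring_1) mpoly" where
  "Var v = Poly_Mapping.single (Poly_Mapping.single v 1) 1"

definition poly_ring :: "'v set \<Rightarrow> ('v, 'a::comm_ring_1) mpoly ring" where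
  "poly_ring V =
    \<lparr>carrier = {p. \<forall>m\<in>Poly_Mapping.keys p. Poly_Mapping.keys m \<subseteq> V},
     monoid.mult = (*), one = 1, ring.zero = 0, add = (+)\<rparr>"

lemma cring_poly_ring: "cring (poly_ring V :: ('v, 'a::comm_ring_1) mpoly ring)"
proof (rule cringI)
  have add: "m \<in> Poly_Mapping.keys p \<or> m \<in> Poly_Mapping.keys q"
    if "m \<in> Poly_Mapping.keys (p + q)" for m and p q :: "('v, 'a) mpoly"
    using that Poly_Mapping.keys_add[of p q] by blast
  have mult: "Poly_Mapping.keys m \<subseteq> V"
    if m: "m \<in> Poly_Mapping.keys (p * q)"
      and pq: "\<forall>m\<in>Poly_Mapping.keys p. Poly_Mapping.keys m \<subseteq> V"
        "\<forall>m\<in>Poly_Mapping.keys q. Poly_Mapping.keys m \<subseteq> V"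
    for m and p q :: "('v, 'a) mpoly"
  proof -
    obtain a b where "m = a + b" "a \<in> Poly_Mapping.keys p" "b \<in> Poly_Mapping.keys q"
      using m keys_mult[of p q] by blast
    then show ?thesis
      using pq Poly_Mapping.keys_add[of a b] by blast
  qed
  show "abelian_group (poly_ring V :: ('v, 'a) mpoly ring)"
  proof (rule abelian_groupI)
    fix x :: "('v, 'a) mpoly"
    assume "x \<in> carrier (poly_ring V)"
    then have "- x \<in> carrier (poly_ring V)" "- x + x = 0"
      by (auto simp: poly_ring_def in_keys_iff)
    then show "\<exists>y\<in>carrier (poly_ring V). y \<oplus>\<^bsub>poly_ring V\<^esub> x = \<zero>\<^bsub>poly_ring V\<^esub>"
      by (intro bexI[of _ "- x"]) (simp_all add: poly_ring_def)
  qed (auto simp: poly_ring_def algebra_simps dest: add)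
  show "Group.comm_monoid (poly_ring V :: ('v, 'a) mpoly ring)"
    by (rule comm_monoidI) (auto simp: poly_ring_def algebra_simps dest: mult)
qed (auto simp: poly_ring_def algebra_simps)

definition poly_subst :: "('v \<Rightarrow> ('u, 'a) mpoly) \<Rightarrow> ('v, 'a::comm_ring_1) mpoly \<Rightarrow> ('u, 'a) mpoly" where
  "poly_subst f p =
    (\<Sum>m\<in>Poly_Mapping.keys p. Poly_Mapping.single 0 (Poly_Mapping.lookup p m) *
       (\<Prod>v\<in>Poly_Mapping.keys m. f v ^ Poly_Mapping.lookup m v))"

definition monomial_weight :: "('v \<Rightarrow> real) \<Rightarrow> ('v \<Rightarrow>\<^sub>0 nat) \<Rightarrow> real" where
  "monomial_weight w m = (\<Sum>v\<in>Poly_Mapping.keys m. real (Poly_Mapping.lookup m v) * w v)"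

text \<open>The sum of all terms of lowest weight; the initial form of \<open>0\<close> is \<open>0\<close>.\<close>

definition initial_form :: "('v \<Rightarrow> real) \<Rightarrow> ('v, 'a::comm_ring_1) mpoly \<Rightarrow> ('v, 'a) mpoly" where
  "initial_form w p =
    (\<Sum>m | m \<in> Poly_Mapping.keys p \<and>
           (\<forall>m'\<in>Poly_Mapping.keys p. monomial_weight w m \<le> monomial_weight w m').
       Poly_Mapping.single m (Poly_Mapping.lookup p m))"

text \<open>The lowest weight of a term (for \<open>p \<noteq> 0\<close>).\<close>

definition poly_weight :: "('v \<Rightarrow> real) \<Rightarrow> ('v, 'a::comm_ring_1) mpoly \<Rightarrow> real" where
  "poly_weight w p = Min (monomial_weight w ` Poly_Mapping.keys p)"

definition initial_ideal ::
    "('v, 'a::comm_ring_1) mpoly ring \<Rightarrow> ('v \<Rightarrow> real) \<Rightarrow> ('v, 'a) mpoly set \<Rightarrow> ('v, 'a) mpoly set" where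
  "initial_ideal R w J = Idl\<^bsub>R\<^esub> (initial_form w ` J)"

text \<open>A binomial is a polynomial with at most two terms, as in Eisenbud and Sturmfels.\<close>

definition binomial_ideal :: "('v, 'a::comm_ring_1) mpoly set \<Rightarrow> ('v, 'a) mpoly ring \<Rightarrow> bool" where
  "binomial_ideal J R \<longleftrightarrow>
    (\<exists>B \<subseteq> carrier R. (\<forall>b\<in>B. card (Poly_Mapping.keys b) \<le> 2) \<and> J = Idl\<^bsub>R\<^esub> B)"

section \<open>The Pluecker ideal\<close>

definition k_subsets :: "nat \<Rightarrow> nat \<Rightarrow> nat set set" where
  "k_subsets k n = {I. I \<subseteq> {1..n} \<and> card I = k}"

text \<open>\<open>nth_elem I t\<close> is the \<open>t\<close>-th smallest element of \<open>I\<close>, counting from \<open>1\<close>.\<close>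

definition nth_elem :: "nat set \<Rightarrow> nat \<Rightarrow> nat" where
  "nth_elem I t = sorted_list_of_set I ! (t - 1)"

text \<open>The indeterminate $x_{ij}$ is \<open>Var (i, j)\<close> with \<open>i\<close> and \<open>j\<close> counted from \<open>1\<close>, whereas
  the entries of \<open>Matrix.mat\<close> are counted from \<open>0\<close>.\<close>

definition pluecker_form :: "nat \<Rightarrow> nat set \<Rightarrow> (nat \<times> nat, 'a::comm_ring_1) mpoly" where
  "pluecker_form k I =
    Determinant.det (Matrix.mat k k (\<lambda>(r, c). Var (r + 1, nth_elem I (c + 1))))"

abbreviation pluecker_ring :: "nat \<Rightarrow> nat \<Rightarrow> (nat set, 'a::comm_ring_1) mpoly ring" where
  "pluecker_ring k n \<equiv> poly_ring (k_subsets k n)"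

definition pluecker_ideal :: "nat \<Rightarrow> nat \<Rightarrow> (nat set, 'a::comm_ring_1) mpoly set" where
  "pluecker_ideal k n =
    a_kernel (pluecker_ring k n) (poly_ring ({1..k} \<times> {1..n})) (poly_subst (pluecker_form k))"

section \<open>Matching fields\<close>

text \<open>Only the values \<open>\<Lambda> I\<close> for \<open>I \<in> k_subsets k n\<close> and the entries \<open>M i j\<close> with
  \<open>i \<in> {1..k}\<close>, \<open>j \<in> {1..n}\<close> are relevant. Coherence is formulated via polynomials over the
  ground field, which is passed as a type argument.\<close>

definition matching_field :: "nat \<Rightarrow> nat \<Rightarrow> (nat set \<Rightarrow> nat \<Rightarrow> nat) \<Rightarrow> bool" where
  "matching_field k n \<Lambda> \<longleftrightarrow> (\<forall>I\<in>k_subsets k n. \<Lambda> I permutes {1..k})"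

definition matching_term ::
    "nat \<Rightarrow> (nat set \<Rightarrow> nat \<Rightarrow> nat) \<Rightarrow> nat set \<Rightarrow> (nat \<times> nat, 'a::comm_ring_1) mpoly" where
  "matching_term k \<Lambda> I = (\<Prod>t\<in>{1..k}. Var (\<Lambda> I t, nth_elem I t))"

definition induces ::
    "'a::field itself \<Rightarrow> nat \<Rightarrow> nat \<Rightarrow> (nat \<Rightarrow> nat \<Rightarrow> real) \<Rightarrow> (nat set \<Rightarrow> nat \<Rightarrow> nat) \<Rightarrow> bool" where
  "induces _ k n M \<Lambda> \<longleftrightarrow>
    (\<forall>I\<in>k_subsets k n.
       initial_form (\<lambda>(i, j). M i j) (pluecker_form k I :: (nat \<times> nat, 'a) mpoly) =
       of_int (sign (\<Lambda> I)) * matching_term k \<Lambda> I)"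

definition coherent_matching_field ::
    "'a::field itself \<Rightarrow> nat \<Rightarrow> nat \<Rightarrow> (nat set \<Rightarrow> nat \<Rightarrow> nat) \<Rightarrow> bool" where
  "coherent_matching_field K k n \<Lambda> \<longleftrightarrow> matching_field k n \<Lambda> \<and> (\<exists>M. induces K k n M \<Lambda>)"

definition pluecker_weight :: "'a::field itself \<Rightarrow> nat \<Rightarrow> (nat \<Rightarrow> nat \<Rightarrow> real) \<Rightarrow> nat set \<Rightarrow> real" where
  "pluecker_weight _ k M I =
    (let w = (\<lambda>(i, j). M i j)
     in poly_weight w (initial_form w (pluecker_form k I :: (nat \<times> nat, 'a) mpoly)))"

text \<open>The initial ideal $\mathrm{in}_{w_M}(\mathcal{I}_{k,n})$.\<close>

definition pluecker_initial_ideal ::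
    "nat \<Rightarrow> nat \<Rightarrow> (nat \<Rightarrow> nat \<Rightarrow> real) \<Rightarrow> (nat set, 'a::field) mpoly set" where
  "pluecker_initial_ideal k n M =
    initial_ideal (pluecker_ring k n) (pluecker_weight TYPE('a) k M) (pluecker_ideal k n)"

definition restrict_matching_field ::
    "(nat set \<Rightarrow> nat \<Rightarrow> nat) \<Rightarrow> nat set \<Rightarrow> (nat set \<Rightarrow> nat \<Rightarrow> nat)" where
  "restrict_matching_field \<Lambda> J = (\<lambda>I. \<Lambda> (nth_elem J ` I))"

section \<open>Tropical line arrangements\<close>

definition tropical_line :: "(nat \<Rightarrow> nat \<Rightarrow> real) \<Rightarrow> nat \<Rightarrow> (real \<times> real) set" where
  "tropical_line M j =
    {p. \<not> (\<lambda>(x2, x3). max 0 (max (x2 - M 2 j) (x3 - M 3 j))) differentiable (at p)}"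

definition cells :: "nat \<Rightarrow> (nat \<Rightarrow> nat \<Rightarrow> real) \<Rightarrow> (real \<times> real) set set" where
  "cells n M = closure ` components (- (\<Union>j\<in>{1..n}. tropical_line M j))"

definition ray_direction :: "nat \<Rightarrow> real \<times> real" where
  "ray_direction i = (if i = 1 then (1, 1) else if i = 2 then (-1, 0) else (0, -1))"

text \<open>The set $S_i$ for a cell \<open>\<tau>\<close>: whether the ray meets the tropical line does not depend on
  the point \<open>x\<close> in the interior of \<open>\<tau>\<close>.\<close>

definition covector ::
    "nat \<Rightarrow> (nat \<Rightarrow> nat \<Rightarrow> real) \<Rightarrow> (real \<times> real) set \<Rightarrow> nat \<Rightarrow> nat set" where
  "covector n M \<tau> i =
    {j\<in>{1..n}. \<forall>x\<in>interior \<tau>. \<exists>t\<ge>0. x + t *\<^sub>R ray_direction i \<in> tropical_line M j}"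

definition coarse_covector ::
    "nat \<Rightarrow> (nat \<Rightarrow> nat \<Rightarrow> real) \<Rightarrow> (real \<times> real) set \<Rightarrow> nat \<times> nat \<times> nat" where
  "coarse_covector n M \<tau> =
    (card (covector n M \<tau> 1), card (covector n M \<tau> 2), card (covector n M \<tau> 3))"

definition hexagon :: "(real \<times> real) set \<Rightarrow> bool" where
  "hexagon P \<longleftrightarrow> polytope P \<and> aff_dim P = 2 \<and> card {e. e edge_of P} = 6"

definition hexagonal :: "'a::field itself \<Rightarrow> (nat set \<Rightarrow> nat \<Rightarrow> nat) \<Rightarrow> bool" where
  "hexagonal K \<Lambda> \<longleftrightarrow> coherent_matching_field K 3 6 \<Lambda> \<and>
    (\<exists>M \<tau>. (\<forall>j\<in>{1..6}. M 1 j = 0) \<and> induces K 3 6 M \<Lambda> \<and>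
       {\<tau>'\<in>cells 6 M. coarse_covector 6 M \<tau>' = (2, 2, 2)} = {\<tau>} \<and> hexagon \<tau>)"

definition non_hexagonal :: "'a::field itself \<Rightarrow> nat \<Rightarrow> (nat set \<Rightarrow> nat \<Rightarrow> nat) \<Rightarrow> bool" where
  "non_hexagonal K n \<Lambda> \<longleftrightarrow>
    (\<forall>J\<in>k_subsets 6 n. \<not> hexagonal K (restrict_matching_field \<Lambda> J))"

end

theory Submission
  imports Defs
begin

text \<open>A chamber of six tropical lines with coarse covector \<open>(2,2,2)\<close> splits the six columns into
  pairs \<open>S\<^sub>1\<close>, \<open>S\<^sub>2\<close>, \<open>S\<^sub>3\<close>, and it is cut out by the half-planes
  \<open>x\<^sub>r - x\<^sub>p \<le> \<beta> p r\<close> for the six ordered pairs of rows, where \<open>\<beta> p r\<close> is the least price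
  of moving a column of \<open>S\<^sub>p\<close> from row \<open>p\<close> to row \<open>r\<close>. Being a hexagon means that no half-plane is
  redundant, that is \<open>\<beta> p r < \<beta> p q + \<beta> q r\<close>: moving directly is cheaper than any detour
  (\<open>hexagonal_cell\<close>). This determines the cheapest matchings of triples of columns
  (\<open>hexagonal_optima_if_irredundant\<close>): a triple with one column from each pair is matched with
  the three rows in the obvious way, and for a triple consisting of \<open>S\<^sub>p\<close> and a column of \<open>S\<^sub>q\<close> the latter stays in
  row \<open>q\<close> while one column of \<open>S\<^sub>p\<close>, the same for both choices in \<open>S\<^sub>q\<close>, moves to the third row. The
  weight matrix of the theorem need not have a hexagonal arrangement itself, but it induces the
  same matchings, and the rest of the argument uses the arrangement through these matchings only.

  Write \<open>[x y z]\<close> for a Pluecker variable, up to sign. With \<open>S\<^sub>p = {a,b}\<close>,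
  \<open>S\<^sub>q = {c,d}\<close>, \<open>S\<^sub>r = {e,f}\<close>, the products \<open>[c b d][f a e]\<close> and \<open>[c a d][f b e]\<close> have the same
  initial monomial, and the rows can be labelled such that their weight is the largest among all
  products of two complementary variables on the six columns
  (\<open>hexagonal_weight_relations\<close>). The matchings above show that two of the three-term
  Pluecker relations have the initial forms \<open>[c a e][c b d] - [c a d][c b e]\<close> and
  \<open>[c a e][f b e] - [f a e][c b e]\<close>. Eliminating \<open>[c a e]\<close> yields the product of \<open>[c b e]\<close> and
  \<open>D = [c b d][f a e] - [c a d][f b e]\<close>. No variable lies in the initial ideal, so if that ideal
  is prime, it contains \<open>D\<close>.

  Then \<open>D\<close> is the initial part of an element of the Pluecker ideal all of whose other terms are
  heavier (\<open>initial_ideal_lift\<close>). The Pluecker ideal is homogeneous with respect to the columns, and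
  no monomial using each of the six columns once is heavier than \<open>D\<close>. Hence \<open>D\<close> itself lies in the Pluecker
  ideal (\<open>poly_subst_column_component_eq_0\<close>). But \<open>D\<close> does not vanish on the matrix with unit
  vectors \<open>e\<^sub>1\<close> as columns \<open>a\<close>, \<open>e\<close>, with \<open>e\<^sub>2\<close> as columns \<open>b\<close>, \<open>c\<close>, and with \<open>e\<^sub>3\<close> as columns
  \<open>d\<close>, \<open>f\<close>, a contradiction (\<open>not_primeideal_pluecker_initial_ideal\<close>).\<close>

section \<open>Weights and substitution of polynomials\<close>

lemma poly_mapping_eq_sum_single:
  "p = (\<Sum>m\<in>Poly_Mapping.keys p. Poly_Mapping.single m (Poly_Mapping.lookup p m))"
  by (rule poly_mapping_eqI) (simp add: lookup_sum lookup_single when_def in_keys_iff)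

lemma lookup_single_mult:
  fixes p :: "('v, 'a::comm_ring_1) mpoly"
  shows "Poly_Mapping.lookup (Poly_Mapping.single k c * p) (k + m) = c * Poly_Mapping.lookup p m"
    and "(\<And>m. u \<noteq> k + m) \<Longrightarrow> Poly_Mapping.lookup (Poly_Mapping.single k c * p) u = 0"
proof -
  have *: "Poly_Mapping.single k c * p =
      (\<Sum>m\<in>Poly_Mapping.keys p. Poly_Mapping.single (k + m) (c * Poly_Mapping.lookup p m))"
    by (subst poly_mapping_eq_sum_single[of p]) (simp add: sum_distrib_left mult_single)
  show "Poly_Mapping.lookup (Poly_Mapping.single k c * p) (k + m) = c * Poly_Mapping.lookup p m"
    unfolding * by (simp add: lookup_sum lookup_single when_def in_keys_iff)
  show "Poly_Mapping.lookup (Poly_Mapping.single k c * p) u = 0" if "\<And>m. u \<noteq> k + m"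
    unfolding * using that[symmetric] by (simp add: lookup_sum lookup_single when_def)
qed

lemma monomial_weight_superset:
  assumes "finite S" "Poly_Mapping.keys m \<subseteq> S"
  shows "monomial_weight w m = (\<Sum>v\<in>S. real (Poly_Mapping.lookup m v) * w v)"
  unfolding monomial_weight_def using assms
  by (intro sum.mono_neutral_left) (auto simp: in_keys_iff)

lemma monomial_weight_add: "monomial_weight w (m + m') = monomial_weight w m + monomial_weight w m'"
proof -
  let ?S = "Poly_Mapping.keys m \<union> Poly_Mapping.keys m'"
  have "monomial_weight w (m + m') = (\<Sum>v\<in>?S. real (Poly_Mapping.lookup (m + m') v) * w v)"
    using Poly_Mapping.keys_add[of m m'] by (intro monomial_weight_superset) auto
  also have "\<dots> = monomial_weight w m + monomial_weight w m'"
    by (subst (1 2) monomial_weight_superset[where S = ?S])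
      (auto simp: lookup_add algebra_simps sum.distrib)
  finally show ?thesis .
qed

lemma monomial_weight_zero: "monomial_weight w 0 = 0"
  by (simp add: monomial_weight_def)

lemma monomial_weight_single: "monomial_weight w (Poly_Mapping.single v k) = real k * w v"
  by (simp add: monomial_weight_def)

text \<open>The image of a single monomial under \<open>poly_subst f\<close>; naming it separates the additive from
  the multiplicative part of the homomorphism property.\<close>

definition monomial_subst :: "('v \<Rightarrow> ('u, 'a) mpoly) \<Rightarrow> ('v \<Rightarrow>\<^sub>0 nat) \<Rightarrow> ('u, 'a::comm_ring_1) mpoly" where
  "monomial_subst f m = (\<Prod>v\<in>Poly_Mapping.keys m. f v ^ Poly_Mapping.lookup m v)"

lemma monomial_subst_superset:
  assumes "finite S" "Poly_Mapping.keys m \<subseteq> S"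
  shows "monomial_subst f m = (\<Prod>v\<in>S. f v ^ Poly_Mapping.lookup m v)"
  unfolding monomial_subst_def using assms
  by (intro prod.mono_neutral_left) (auto simp: in_keys_iff)

lemma monomial_subst_add: "monomial_subst f (m + m') = monomial_subst f m * monomial_subst f m'"
proof -
  let ?S = "Poly_Mapping.keys m \<union> Poly_Mapping.keys m'"
  have "monomial_subst f (m + m') = (\<Prod>v\<in>?S. f v ^ Poly_Mapping.lookup (m + m') v)"
    using Poly_Mapping.keys_add[of m m'] by (intro monomial_subst_superset) auto
  also have "\<dots> = monomial_subst f m * monomial_subst f m'"
    by (subst (1 2) monomial_subst_superset[where S = ?S])
      (auto simp: lookup_add power_add prod.distrib)
  finally show ?thesis .
qed

lemma poly_subst_superset:
  assumes "finite S" "Poly_Mapping.keys p \<subseteq> S"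
  shows "poly_subst f p = (\<Sum>m\<in>S. Poly_Mapping.single 0 (Poly_Mapping.lookup p m) * monomial_subst f m)"
  unfolding poly_subst_def monomial_subst_def using assms
  by (intro sum.mono_neutral_left) (auto simp: in_keys_iff)

lemma poly_subst_add: "poly_subst f (p + q) = poly_subst f p + poly_subst f q"
proof -
  let ?S = "Poly_Mapping.keys p \<union> Poly_Mapping.keys q"
  have "poly_subst f (p + q) =
      (\<Sum>m\<in>?S. Poly_Mapping.single 0 (Poly_Mapping.lookup (p + q) m) * monomial_subst f m)"
    using Poly_Mapping.keys_add[of p q] by (intro poly_subst_superset) auto
  also have "\<dots> = poly_subst f p + poly_subst f q"
    by (subst (1 2) poly_subst_superset[where S = ?S])
      (auto simp: lookup_add single_add algebra_simps sum.distrib)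
  finally show ?thesis .
qed

lemma poly_subst_zero: "poly_subst f 0 = 0"
  by (simp add: poly_subst_def)

lemma poly_subst_uminus: "poly_subst f (- p) = - poly_subst f p"
  using poly_subst_add[of f p "- p"] by (simp add: poly_subst_zero add_eq_0_iff)

lemma poly_subst_sum: "poly_subst f (sum g S) = (\<Sum>x\<in>S. poly_subst f (g x))"
  by (induction S rule: infinite_finite_induct) (auto simp: poly_subst_zero poly_subst_add)

lemma poly_subst_single:
  "poly_subst f (Poly_Mapping.single m c) = Poly_Mapping.single 0 c * monomial_subst f m"
  by (subst poly_subst_superset[of "{m}"]) auto

lemma poly_subst_Var: "poly_subst f (Var v) = f v"
  unfolding Var_def poly_subst_single by (simp add: monomial_subst_def)

lemma poly_subst_mult:
  fixes f :: "'v \<Rightarrow> ('u, 'a::comm_ring_1) mpoly"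
  shows "poly_subst f (p * q) = poly_subst f p * poly_subst f q"
proof -
  have "poly_subst f (Poly_Mapping.single m c * Poly_Mapping.single m' c') =
      poly_subst f (Poly_Mapping.single m c) * poly_subst f (Poly_Mapping.single m' c')"
    for m m' :: "'v \<Rightarrow>\<^sub>0 nat" and c c' :: 'a
  proof -
    have *: "Poly_Mapping.single 0 (c * c') = Poly_Mapping.single 0 c * (Poly_Mapping.single 0 c' :: ('u, 'a) mpoly)"
      by (simp add: mult_single)
    have "poly_subst f (Poly_Mapping.single m c * Poly_Mapping.single m' c') =
        Poly_Mapping.single 0 (c * c') * (monomial_subst f m * monomial_subst f m')"
      by (simp only: mult_single poly_subst_single monomial_subst_add)
    also have "\<dots> = poly_subst f (Poly_Mapping.single m c) * poly_subst f (Poly_Mapping.single m' c')"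
      unfolding * poly_subst_single by (simp only: ac_simps)
    finally show ?thesis .
  qed
  then show ?thesis
    by (subst (1 2) poly_mapping_eq_sum_single, subst (3) poly_mapping_eq_sum_single[of p],
        subst (3) poly_mapping_eq_sum_single[of q])
      (simp add: sum_product poly_subst_sum)
qed

lemma poly_subst_diff: "poly_subst f (p - q) = poly_subst f p - poly_subst f q"
  using poly_subst_add[of f p "- q"] by (simp add: poly_subst_uminus)

lemma monomial_weight_prod:
  assumes "\<And>v u. v \<in> S \<Longrightarrow> u \<in> Poly_Mapping.keys (g v) \<Longrightarrow> monomial_weight w u = c v"
    and "u \<in> Poly_Mapping.keys (\<Prod>v\<in>S. g v :: ('u, 'a::comm_ring_1) mpoly)" and "finite S"
  shows "monomial_weight w u = (\<Sum>v\<in>S. c v)"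
  using assms(3,1,2)
proof (induction S arbitrary: u rule: finite_induct)
  case empty
  then show ?case by (simp add: monomial_weight_zero)
next
  case (insert x S)
  have "u \<in> Poly_Mapping.keys (g x * (\<Prod>v\<in>S. g v))" using insert by simp
  then obtain a b where ab: "u = a + b" "a \<in> Poly_Mapping.keys (g x)"
    "b \<in> Poly_Mapping.keys (\<Prod>v\<in>S. g v)"
    using keys_mult by blast
  then show ?case using insert by (simp add: monomial_weight_add)
qed

text \<open>If each polynomial \<open>f v\<close> is homogeneous of weight \<open>w' v\<close>, substitution transports weights. It
  is used for the gradings by columns.\<close>

lemma monomial_weight_monomial_subst:
  assumes "\<And>v u. v \<in> Poly_Mapping.keys m \<Longrightarrow> u \<in> Poly_Mapping.keys (f v) \<Longrightarrow> monomial_weight w u = w' v"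
    and "u \<in> Poly_Mapping.keys (monomial_subst f m)"
  shows "monomial_weight w u = monomial_weight w' m"
proof -
  have "monomial_weight w u = real k * w' v"
    if "v \<in> Poly_Mapping.keys m" "u \<in> Poly_Mapping.keys (f v ^ k)" for v u k
    using monomial_weight_prod[of "{..<k}" "\<lambda>_. f v" w "\<lambda>_. w' v" u] that assms(1) by simp
  then show ?thesis
    using monomial_weight_prod[of "Poly_Mapping.keys m" "\<lambda>v. f v ^ Poly_Mapping.lookup m v" w
        "\<lambda>v. real (Poly_Mapping.lookup m v) * w' v" u] assms(2)
    unfolding monomial_subst_def monomial_weight_def[of w' m] by simp
qed

lemma lookup_poly_subst:
  fixes f :: "'v \<Rightarrow> ('u, 'a::comm_ring_1) mpoly"
  shows "Poly_Mapping.lookup (poly_subst f p) u =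
    (\<Sum>m\<in>Poly_Mapping.keys p. Poly_Mapping.lookup p m * Poly_Mapping.lookup (monomial_subst f m) u)"
proof -
  have "Poly_Mapping.lookup (Poly_Mapping.single 0 c * q) u = c * Poly_Mapping.lookup q u" for c and q :: "('u, 'a) mpoly"
    using lookup_single_mult(1)[of 0 c q u] by simp
  then show ?thesis
    unfolding poly_subst_def monomial_subst_def[symmetric] lookup_sum by simp
qed

lemma lookup_initial_form:
  "Poly_Mapping.lookup (initial_form w p) m =
    (if m \<in> Poly_Mapping.keys p \<and> (\<forall>m'\<in>Poly_Mapping.keys p. monomial_weight w m \<le> monomial_weight w m')
     then Poly_Mapping.lookup p m else 0)"
  unfolding initial_form_def by (simp add: lookup_sum lookup_single when_def)

lemma keys_initial_form:
  "Poly_Mapping.keys (initial_form w p) =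
    {m \<in> Poly_Mapping.keys p. \<forall>m'\<in>Poly_Mapping.keys p. monomial_weight w m \<le> monomial_weight w m'}"
proof (rule Set.set_eqI)
  fix m
  show "m \<in> Poly_Mapping.keys (initial_form w p) \<longleftrightarrow>
    m \<in> {m \<in> Poly_Mapping.keys p. \<forall>m'\<in>Poly_Mapping.keys p. monomial_weight w m \<le> monomial_weight w m'}"
    by (cases "m \<in> Poly_Mapping.keys p \<and>
        (\<forall>m'\<in>Poly_Mapping.keys p. monomial_weight w m \<le> monomial_weight w m')")
      (simp_all only: in_keys_iff[of m "initial_form w p"] lookup_initial_form, auto simp: in_keys_iff)
qed

lemma initial_form_add:
  assumes "\<And>m. m \<in> Poly_Mapping.keys h \<Longrightarrow> monomial_weight w m = W"
    and "\<And>m. m \<in> Poly_Mapping.keys t \<Longrightarrow> W < monomial_weight w m" and "h \<noteq> 0"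
  shows "initial_form w (h + t) = h"
proof (rule poly_mapping_eqI)
  fix m
  obtain m0 where m0: "m0 \<in> Poly_Mapping.keys h" using \<open>h \<noteq> 0\<close> by (metis keys_eq_empty ex_in_conv)
  have disj: "m \<in> Poly_Mapping.keys h \<Longrightarrow> Poly_Mapping.lookup t m = 0" for m
    using assms(1,2) by (metis in_keys_iff less_irrefl)
  have keys: "m \<in> Poly_Mapping.keys (h + t) \<longleftrightarrow> m \<in> Poly_Mapping.keys h \<or> m \<in> Poly_Mapping.keys t" for m
    using disj[of m] unfolding in_keys_iff lookup_add by (cases "Poly_Mapping.lookup h m = 0") auto
  show "Poly_Mapping.lookup (initial_form w (h + t)) m = Poly_Mapping.lookup h m"
  proof (cases "m \<in> Poly_Mapping.keys h")
    case True
    then have "\<forall>m'\<in>Poly_Mapping.keys (h + t). monomial_weight w m \<le> monomial_weight w m'"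
      using assms(1)[OF True] assms(1,2) keys by (metis less_imp_le order_refl)
    then show ?thesis using True disj[OF True] by (simp add: lookup_initial_form keys lookup_add)
  next
    case False
    have "\<not> (m \<in> Poly_Mapping.keys (h + t) \<and>
        (\<forall>m'\<in>Poly_Mapping.keys (h + t). monomial_weight w m \<le> monomial_weight w m'))"
    proof
      assume *: "m \<in> Poly_Mapping.keys (h + t) \<and>
        (\<forall>m'\<in>Poly_Mapping.keys (h + t). monomial_weight w m \<le> monomial_weight w m')"
      then have "W < monomial_weight w m" using False assms(2) keys by blast
      moreover have "monomial_weight w m \<le> monomial_weight w m0" using * m0 keys by blast
      ultimately show False using assms(1)[OF m0] by simp
    qed
    then show ?thesis using False by (simp only: lookup_initial_form in_keys_iff if_False not_not)
  qed
qed

section \<open>Ideals and initial ideals of a polynomial ring\<close>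

lemma carrier_poly_ring:
  "p \<in> carrier (poly_ring V) \<longleftrightarrow> (\<forall>m\<in>Poly_Mapping.keys p. Poly_Mapping.keys m \<subseteq> V)"
  by (simp add: poly_ring_def)

lemma poly_ring_ops [simp]:
  "x \<otimes>\<^bsub>poly_ring V\<^esub> y = x * y" "\<one>\<^bsub>poly_ring V\<^esub> = 1" "\<zero>\<^bsub>poly_ring V\<^esub> = 0"
  "x \<oplus>\<^bsub>poly_ring V\<^esub> y = x + y"
  by (simp_all add: poly_ring_def)

lemma a_inv_poly_ring:
  assumes "x \<in> carrier (poly_ring V)"
  shows "\<ominus>\<^bsub>poly_ring V\<^esub> x = - x"
proof -
  interpret cring "poly_ring V" by (rule cring_poly_ring)
  have "- x \<in> carrier (poly_ring V)" using assms by (simp add: carrier_poly_ring in_keys_iff)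
  then show ?thesis using minus_equality[of "- x" x] assms by simp
qed

lemma poly_ring_idealD:
  fixes I :: "('v, 'a::comm_ring_1) mpoly set"
  assumes "ideal I (poly_ring V)"
  shows "I \<subseteq> carrier (poly_ring V)" "0 \<in> I" "x \<in> I \<Longrightarrow> y \<in> I \<Longrightarrow> x + y \<in> I"
    "x \<in> I \<Longrightarrow> - x \<in> I" "x \<in> I \<Longrightarrow> y \<in> carrier (poly_ring V) \<Longrightarrow> y * x \<in> I"
    "x \<in> I \<Longrightarrow> y \<in> I \<Longrightarrow> x - y \<in> I"
proof -
  interpret ideal I "poly_ring V" by fact
  show sub: "I \<subseteq> carrier (poly_ring V)" by (rule a_subset)
  show "0 \<in> I" using additive_subgroup.zero_closed[OF is_additive_subgroup] by simp
  show add: "x + y \<in> I" if "x \<in> I" "y \<in> I" for x y using additive_subgroup.a_closed[OF is_additive_subgroup that] by simp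
  show neg: "- x \<in> I" if "x \<in> I" for x
    using additive_subgroup.a_inv_closed[OF is_additive_subgroup that] a_inv_poly_ring sub that by (metis subsetD)
  show "y * x \<in> I" if "x \<in> I" "y \<in> carrier (poly_ring V)" using I_l_closed[OF that] by simp
  show "x - y \<in> I" if "x \<in> I" "y \<in> I" using add[OF that(1) neg[OF that(2)]] by simp
qed

text \<open>Closure under multiplication needs to be checked for terms only, because every polynomial is a
  sum of terms; negation is multiplication by \<open>- 1\<close>.\<close>

lemma poly_ring_idealI:
  fixes I :: "('v, 'a::comm_ring_1) mpoly set"
  assumes "I \<subseteq> carrier (poly_ring V)" "0 \<in> I" "\<And>x y. x \<in> I \<Longrightarrow> y \<in> I \<Longrightarrow> x + y \<in> I"
    and mult: "\<And>m c x. Poly_Mapping.keys m \<subseteq> V \<Longrightarrow> x \<in> I \<Longrightarrow> Poly_Mapping.single m c * x \<in> I"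
  shows "ideal I (poly_ring V)"
proof -
  interpret cring "poly_ring V" by (rule cring_poly_ring)
  have sum: "(\<Sum>x\<in>S. g x) \<in> I" if "\<And>x. x \<in> S \<Longrightarrow> g x \<in> I" for S :: "('v \<Rightarrow>\<^sub>0 nat) set" and g
    using that by (induction S rule: infinite_finite_induct) (auto intro: assms)
  have l: "y * x \<in> I" if "x \<in> I" "y \<in> carrier (poly_ring V)" for x y
  proof -
    have "(\<Sum>m\<in>Poly_Mapping.keys y. Poly_Mapping.single m (Poly_Mapping.lookup y m) * x) \<in> I"
      using that by (intro sum mult) (auto simp: carrier_poly_ring)
    then show ?thesis by (metis poly_mapping_eq_sum_single sum_distrib_right)
  qed
  have neg: "- x \<in> I" if "x \<in> I" for x
    using l[OF that, of "- 1"] by (simp add: carrier_poly_ring in_keys_iff)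
  show ?thesis
  proof (rule idealI)
    show "subgroup I (add_monoid (poly_ring V))"
    proof (rule subgroup.intro)
      fix x assume "x \<in> I"
      then have "inv\<^bsub>add_monoid (poly_ring V)\<^esub> x = - x"
        using a_inv_poly_ring[of x V] assms(1) unfolding a_inv_def by blast
      then show "inv\<^bsub>add_monoid (poly_ring V)\<^esub> x \<in> I"
        using neg[OF \<open>x \<in> I\<close>] by (simp only:)
    qed (use assms(1-3) in simp_all)
    show "x \<otimes>\<^bsub>poly_ring V\<^esub> a \<in> I" if "a \<in> I" "x \<in> carrier (poly_ring V)" for a x
      using l[OF that] by simp
    show "a \<otimes>\<^bsub>poly_ring V\<^esub> x \<in> I" if "a \<in> I" "x \<in> carrier (poly_ring V)" for a x
      using l[OF that] by (simp add: mult.commute)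
  qed (rule ring_axioms)
qed

lemma single_in_carrier: "Poly_Mapping.keys m \<subseteq> V \<Longrightarrow> Poly_Mapping.single m c \<in> carrier (poly_ring V)"
  by (simp add: carrier_poly_ring)

text \<open>Every weight-homogeneous component of an element of the initial ideal is the lowest part of an
  element of the ideal. The reason is that the polynomials all of whose components can be lifted in
  this way already form an ideal: to lift a component of \<open>x\<^sup>m * p\<close>, multiply by \<open>x\<^sup>m\<close> a lift of the component of \<open>p\<close>
  whose weight is lower by the weight of \<open>m\<close>. The component for \<open>W\<close> may vanish, in which case
  \<open>0\<close> is a lift.\<close>

lemma initial_ideal_lift:
  fixes I :: "('v, 'a::comm_ring_1) mpoly set"
  assumes I: "ideal I (poly_ring V)" and p: "p \<in> initial_ideal (poly_ring V) w I"
  shows "\<exists>F\<in>I. \<forall>m. (monomial_weight w m < W \<longrightarrow> Poly_Mapping.lookup F m = 0) \<and>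
    (monomial_weight w m = W \<longrightarrow> Poly_Mapping.lookup F m = Poly_Mapping.lookup p m)"
proof -
  interpret cring "poly_ring V" by (rule cring_poly_ring)
  define lifts where "lifts F p W \<longleftrightarrow> (\<forall>m. (monomial_weight w m < W \<longrightarrow> Poly_Mapping.lookup F m = 0) \<and>
    (monomial_weight w m = W \<longrightarrow> Poly_Mapping.lookup F m = Poly_Mapping.lookup p m))"
    for F p :: "('v, 'a) mpoly" and W
  define T where "T = {p \<in> carrier (poly_ring V). \<forall>W. \<exists>F\<in>I. lifts F p W}"
  note ID = poly_ring_idealD[OF I]
  have "ideal T (poly_ring V)"
  proof (rule poly_ring_idealI)
    show "T \<subseteq> carrier (poly_ring V)" by (auto simp: T_def)
    have "lifts 0 0 W" for W by (simp add: lifts_def)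
    then show "0 \<in> T" using ID(2) unfolding T_def by (auto simp: carrier_poly_ring)
    show "x + y \<in> T" if "x \<in> T" "y \<in> T" for x y
    proof -
      have "\<exists>F\<in>I. lifts F (x + y) W" for W
      proof -
        obtain F G where "F \<in> I" "G \<in> I" "lifts F x W" "lifts G y W"
          using \<open>x \<in> T\<close> \<open>y \<in> T\<close> unfolding T_def by blast
        then have "F + G \<in> I" "lifts (F + G) (x + y) W"
          using ID(3) by (auto simp: lifts_def lookup_add)
        then show ?thesis by blast
      qed
      moreover have "x + y \<in> carrier (poly_ring V)" using a_closed[of x y] that by (simp add: T_def)
      ultimately show ?thesis by (simp add: T_def)
    qed
    show "Poly_Mapping.single m c * x \<in> T" if "Poly_Mapping.keys m \<subseteq> V" "x \<in> T" for m c x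
    proof -
      note car = single_in_carrier[OF that(1), of c]
      have "\<exists>F\<in>I. lifts F (Poly_Mapping.single m c * x) W" for W
      proof -
        obtain F where F: "F \<in> I" "lifts F x (W - monomial_weight w m)"
          using \<open>x \<in> T\<close> unfolding T_def by blast
        have "lifts (Poly_Mapping.single m c * F) (Poly_Mapping.single m c * x) W"
          unfolding lifts_def
        proof
          fix u
          show "(monomial_weight w u < W \<longrightarrow> Poly_Mapping.lookup (Poly_Mapping.single m c * F) u = 0) \<and>
            (monomial_weight w u = W \<longrightarrow> Poly_Mapping.lookup (Poly_Mapping.single m c * F) u =
              Poly_Mapping.lookup (Poly_Mapping.single m c * x) u)"
          proof (cases "\<exists>k. u = m + k")
            case True
            then obtain k where "u = m + k" by blast
            then show ?thesis using F(2)
              by (auto simp: lookup_single_mult(1) monomial_weight_add lifts_def)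
          next
            case False
            then show ?thesis by (simp add: lookup_single_mult(2))
          qed
        qed
        moreover have "Poly_Mapping.single m c * F \<in> I" by (rule ID(5)[OF F(1) car])
        ultimately show ?thesis by blast
      qed
      moreover have "Poly_Mapping.single m c * x \<in> carrier (poly_ring V)"
        using m_closed[OF car, of x] that(2) by (simp add: T_def)
      ultimately show ?thesis by (simp add: T_def)
    qed
  qed
  moreover have "initial_form w ` I \<subseteq> T"
  proof (rule image_subsetI)
    fix f assume f: "f \<in> I"
    have "\<exists>F\<in>I. lifts F (initial_form w f) W" for W
    proof (cases "\<exists>m\<in>Poly_Mapping.keys (initial_form w f). monomial_weight w m = W")
      case True
      then obtain m where m: "m \<in> Poly_Mapping.keys f" "monomial_weight w m = W"
        "\<forall>m'\<in>Poly_Mapping.keys f. W \<le> monomial_weight w m'"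
        by (auto simp: keys_initial_form)
      have "lifts f (initial_form w f) W"
        unfolding lifts_def lookup_initial_form
      proof (intro allI conjI impI)
        fix u assume "monomial_weight w u < W"
        then show "Poly_Mapping.lookup f u = 0" using m(3) by (metis in_keys_iff not_less)
      next
        fix u assume "monomial_weight w u = W"
        then show "Poly_Mapping.lookup f u = (if u \<in> Poly_Mapping.keys f \<and>
            (\<forall>m'\<in>Poly_Mapping.keys f. monomial_weight w u \<le> monomial_weight w m')
            then Poly_Mapping.lookup f u else 0)"
          using m(3) by (simp add: in_keys_iff)
      qed
      then show ?thesis using f by blast
    next
      case False
      then have "lifts 0 (initial_form w f) W"
        by (auto simp: lifts_def in_keys_iff)
      then show ?thesis using ID(2) by blast
    qed
    moreover have "initial_form w f \<in> carrier (poly_ring V)"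
    proof -
      have "f \<in> carrier (poly_ring V)" using ID(1) f by blast
      then show ?thesis by (auto simp: carrier_poly_ring keys_initial_form)
    qed
    ultimately show "initial_form w f \<in> T" by (simp add: T_def)
  qed
  ultimately have "initial_ideal (poly_ring V) w I \<subseteq> T"
    unfolding initial_ideal_def by (rule genideal_minimal)
  then show ?thesis using p unfolding T_def lifts_def by blast
qed

lemma poly_subst_in_carrier:
  assumes "\<And>v. v \<in> V \<Longrightarrow> f v \<in> carrier (poly_ring U)" and p: "p \<in> carrier (poly_ring V)"
  shows "poly_subst f p \<in> carrier (poly_ring U)"
proof -
  interpret cring "poly_ring U" by (rule cring_poly_ring)
  have pow: "x ^ k \<in> carrier (poly_ring U)" if "x \<in> carrier (poly_ring U)" for x k
    using that m_closed one_closed by (induction k) auto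
  have prod: "prod g S \<in> carrier (poly_ring U)" if "\<And>x. x \<in> S \<Longrightarrow> g x \<in> carrier (poly_ring U)"
    for S and g :: "'a \<Rightarrow> ('b, 'c) mpoly"
    using that one_closed m_closed by (induction S rule: infinite_finite_induct) auto
  have sum: "sum g S \<in> carrier (poly_ring U)" if "\<And>x. x \<in> S \<Longrightarrow> g x \<in> carrier (poly_ring U)"
    for S and g :: "('a \<Rightarrow>\<^sub>0 nat) \<Rightarrow> ('b, 'c) mpoly"
    using that zero_closed a_closed by (induction S rule: infinite_finite_induct) auto
  have mult: "x * y \<in> carrier (poly_ring U)" if "x \<in> carrier (poly_ring U)" "y \<in> carrier (poly_ring U)" for x y
    using m_closed[OF that] by simp
  show ?thesis
    unfolding poly_subst_def using assms
    by (intro sum mult prod pow single_in_carrier) (auto simp: carrier_poly_ring[of p])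
qed

lemma ideal_kernel_poly_subst:
  assumes "\<And>v. v \<in> V \<Longrightarrow> f v \<in> carrier (poly_ring U)"
  shows "ideal (a_kernel (poly_ring V) (poly_ring U) (poly_subst f)) (poly_ring V)"
proof (rule ring_hom_ring.kernel_is_ideal, rule ring_hom_ringI2)
  show "poly_subst f \<in> Ring.ring_hom (poly_ring V) (poly_ring U)"
    by (rule ring_hom_memI)
      (auto simp: poly_subst_mult poly_subst_add poly_subst_in_carrier[OF assms]
        poly_subst_single[of f 0 1, simplified] monomial_subst_def)
qed (use cring_poly_ring cring.axioms(1) in blast)+

section \<open>Cheapest matchings and three-by-three determinants\<close>

text \<open>A strictly cheapest matching of three columns with three rows; the inequalities compare it with
  the five others.\<close>

definition optimal :: "(nat \<Rightarrow> nat \<Rightarrow> real) \<Rightarrow> nat \<Rightarrow> nat \<Rightarrow> nat \<Rightarrow> nat \<Rightarrow> nat \<Rightarrow> nat \<Rightarrow> bool" where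
  "optimal A i x j y k z \<longleftrightarrow>
     A i x + A j y + A k z < A i x + A k y + A j z \<and>
     A i x + A j y + A k z < A j x + A i y + A k z \<and>
     A i x + A j y + A k z < A j x + A k y + A i z \<and>
     A i x + A j y + A k z < A k x + A i y + A j z \<and>
     A i x + A j y + A k z < A k x + A j y + A i z"

lemma optimal_swap:
  "optimal A i x j y k z \<Longrightarrow> optimal A j y i x k z"
  "optimal A i x j y k z \<Longrightarrow> optimal A i x k z j y"
  by (auto simp: optimal_def algebra_simps)

lemma rows_distinct: "{p,q,r} = {1,2,3::nat} \<Longrightarrow> p \<noteq> q \<and> p \<noteq> r \<and> q \<noteq> r"
  by (drule arg_cong[where f = card]) (auto simp: card_insert_if split: if_splits)

lemma rows_cases:
  assumes "{p,q,r} = {1,2,3::nat}" and "{i,j,k} = {1,2,3}"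
  obtains "i = p" "j = q" "k = r" | "i = p" "j = r" "k = q" | "i = q" "j = p" "k = r"
    | "i = q" "j = r" "k = p" | "i = r" "j = p" "k = q" | "i = r" "j = q" "k = p"
proof -
  have "i \<in> {p,q,r}" "j \<in> {p,q,r}" "k \<in> {p,q,r}" using assms by blast+
  moreover have "i \<noteq> j" "i \<noteq> k" "j \<noteq> k" using rows_distinct[OF assms(2)] by auto
  ultimately show thesis using that by blast
qed

lemma det_mat_2:
  "Determinant.det (Matrix.mat 2 2 f) = f (0,0) * f (1,1) - f (0,1) * (f (1,0) :: 'a::comm_ring_1)"
proof -
  have "Determinant.det (Matrix.mat 2 2 f) =
      (\<Sum>j<2. Matrix.mat 2 2 f $$ (0,j) * cofactor (Matrix.mat 2 2 f) 0 j)"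
    by (rule laplace_expansion_row) auto
  then show ?thesis
    by (simp add: numeral_2_eq_2 lessThan_Suc cofactor_def mat_delete_def det_single)
qed

lemma det_mat_3:
  fixes f :: "nat \<times> nat \<Rightarrow> 'a::comm_ring_1"
  shows "Determinant.det (Matrix.mat 3 3 f) = f (0,0) * (f (1,1) * f (2,2) - f (1,2) * f (2,1))
    - f (0,1) * (f (1,0) * f (2,2) - f (1,2) * f (2,0)) + f (0,2) * (f (1,0) * f (2,1) - f (1,1) * f (2,0))"
proof -
  have "Determinant.det (Matrix.mat 3 3 f) =
      (\<Sum>j<3. Matrix.mat 3 3 f $$ (0,j) * cofactor (Matrix.mat 3 3 f) 0 j)"
    by (rule laplace_expansion_row) auto
  moreover have "mat_delete (Matrix.mat 3 3 f) 0 j =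
      Matrix.mat 2 2 (\<lambda>(r, c). f (Suc r, if c < j then c else Suc c))" if "j < 3" for j
    using that by (auto simp: mat_delete_def intro!: eq_matI)
  ultimately show ?thesis
    by (simp add: numeral_3_eq_3 lessThan_Suc cofactor_def det_mat_2[unfolded numeral_2_eq_2] numeral_2_eq_2 algebra_simps)
qed

text \<open>The determinant of the generic columns \<open>x\<close>, \<open>y\<close>, \<open>z\<close> in this order. Unlike
  \<open>pluecker_form\<close> it does not sort the columns, so that it is alternating.\<close>

definition det_form :: "nat \<Rightarrow> nat \<Rightarrow> nat \<Rightarrow> (nat \<times> nat, 'a::comm_ring_1) mpoly" where
  "det_form x y z =
     Var (1,x) * (Var (2,y) * Var (3,z) - Var (2,z) * Var (3,y))
     - Var (1,y) * (Var (2,x) * Var (3,z) - Var (2,z) * Var (3,x))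
     + Var (1,z) * (Var (2,x) * Var (3,y) - Var (2,y) * Var (3,x))"

text \<open>Listing the columns by rows makes equality of these monomials componentwise.\<close>

definition row_monomial :: "nat \<Rightarrow> nat \<Rightarrow> nat \<Rightarrow> (nat \<times> nat \<Rightarrow>\<^sub>0 nat)" where
  "row_monomial x y z = Poly_Mapping.single (1,x) 1 + Poly_Mapping.single (2,y) 1 + Poly_Mapping.single (3,z) 1"

lemma nth_elem_sorted:
  assumes "x < y" "y < z"
  shows "nth_elem {x,y,z} 1 = x" "nth_elem {x,y,z} 2 = y" "nth_elem {x,y,z} 3 = z"
proof -
  have "sorted_list_of_set {x,y,z} = [x,y,z]"
    using sorted_list_of_set.idem_if_sorted_distinct[of "[x,y,z]"] assms by simp
  then show "nth_elem {x,y,z} 1 = x" "nth_elem {x,y,z} 2 = y" "nth_elem {x,y,z} 3 = z"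
    by (simp_all add: nth_elem_def)
qed

lemma pluecker_form_sorted:
  assumes "x < y" "y < z"
  shows "pluecker_form 3 {x,y,z} = det_form x y z"
  using nth_elem_sorted[OF assms]
  unfolding pluecker_form_def det_mat_3 det_form_def by (simp add: numeral_2_eq_2 numeral_3_eq_3)

lemma wlog_sorted_triple:
  fixes x y z :: nat
  assumes "x \<noteq> y" "x \<noteq> z" "y \<noteq> z"
    and "\<And>x y z. P x y z \<Longrightarrow> P y x z" and "\<And>x y z. P x y z \<Longrightarrow> P x z y"
    and "\<And>x y z. x < y \<Longrightarrow> y < z \<Longrightarrow> P x y z"
  shows "P x y z"
proof -
  consider "x < y" "y < z" | "x < z" "z < y" | "y < x" "x < z" | "y < z" "z < x"
    | "z < x" "x < y" | "z < y" "y < x"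
    using assms(1-3) by linarith
  then show ?thesis by cases (use assms(4-6) in blast)+
qed

lemma row_monomial_inject:
  "row_monomial x y z = row_monomial x' y' z' \<longleftrightarrow> x = x' \<and> y = y' \<and> z = z'"
proof
  assume eq: "row_monomial x y z = row_monomial x' y' z'"
  have lookup: "Poly_Mapping.lookup (row_monomial x y z) (i, j) =
      (if (i, j) \<in> {(1,x),(2,y),(3,z)} then 1 else 0)" for i j x y z
    by (auto simp: row_monomial_def lookup_add lookup_single when_def)
  have "x = x'" using arg_cong[OF eq, of "\<lambda>m. Poly_Mapping.lookup m (1, x)"]
    unfolding lookup by (simp split: if_splits)
  moreover have "y = y'" using arg_cong[OF eq, of "\<lambda>m. Poly_Mapping.lookup m (2, y)"]
    unfolding lookup by (simp split: if_splits)
  moreover have "z = z'" using arg_cong[OF eq, of "\<lambda>m. Poly_Mapping.lookup m (3, z)"]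
    unfolding lookup by (simp split: if_splits)
  ultimately show "x = x' \<and> y = y' \<and> z = z'" by simp
qed simp

lemma monomial_weight_row_monomial:
  "monomial_weight w (row_monomial x y z) = w (1,x) + w (2,y) + w (3,z)"
  by (simp add: row_monomial_def monomial_weight_add monomial_weight_single)

lemma Var_mult_eq_single:
  "Var (1,x) * (Var (2,y) * Var (3,z)) = (Poly_Mapping.single (row_monomial x y z) 1 :: (nat \<times> nat, 'a::comm_ring_1) mpoly)"
  by (simp add: Var_def mult_single row_monomial_def add.assoc)

lemma keys_det_form:
  assumes "x \<noteq> y" "x \<noteq> z" "y \<noteq> z"
  shows "Poly_Mapping.keys (det_form x y z :: (nat \<times> nat, 'a::field) mpoly) =
    {row_monomial x y z, row_monomial x z y, row_monomial y x z, row_monomial y z x,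
     row_monomial z x y, row_monomial z y x}"
proof -
  have "det_form x y z =
     (Poly_Mapping.single (row_monomial x y z) 1 - Poly_Mapping.single (row_monomial x z y) 1
     - Poly_Mapping.single (row_monomial y x z) 1 + Poly_Mapping.single (row_monomial y z x) 1
     + Poly_Mapping.single (row_monomial z x y) 1 - Poly_Mapping.single (row_monomial z y x) 1
     :: (nat \<times> nat, 'a) mpoly)"
    unfolding det_form_def Var_mult_eq_single[symmetric] by (simp add: algebra_simps)
  then have "Poly_Mapping.lookup (det_form x y z :: (nat \<times> nat, 'a) mpoly) m =
     (1 when row_monomial x y z = m) - (1 when row_monomial x z y = m)
     - (1 when row_monomial y x z = m) + (1 when row_monomial y z x = m)
     + (1 when row_monomial z x y = m) - (1 when row_monomial z y x = m)" for m
    by (simp add: lookup_add lookup_minus lookup_single)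
  then show ?thesis
    using assms by (auto simp: in_keys_iff when_def row_monomial_inject split: if_splits)
qed

lemma det_form_swap: "det_form y x z = - det_form x y z" "det_form x z y = - det_form x y z"
  by (simp_all add: det_form_def algebra_simps)

lemma pluecker_form_eq_det_form:
  assumes "x \<noteq> y" "x \<noteq> z" "y \<noteq> z"
  shows "pluecker_form 3 {x,y,z} = (det_form x y z :: (nat \<times> nat, 'a::comm_ring_1) mpoly) \<or>
    pluecker_form 3 {x,y,z} = - (det_form x y z :: (nat \<times> nat, 'a) mpoly)"
  using assms
proof (rule wlog_sorted_triple)
  fix x y z
  assume *: "pluecker_form 3 {x,y,z} = (det_form x y z :: (nat \<times> nat, 'a) mpoly) \<or>
    pluecker_form 3 {x,y,z} = - (det_form x y z :: (nat \<times> nat, 'a) mpoly)"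
  have "{y,x,z} = {x,y,z}" "{x,z,y} = {x,y,z}" by auto
  then show "pluecker_form 3 {y,x,z} = (det_form y x z :: (nat \<times> nat, 'a) mpoly) \<or>
    pluecker_form 3 {y,x,z} = - (det_form y x z :: (nat \<times> nat, 'a) mpoly)"
    and "pluecker_form 3 {x,z,y} = (det_form x z y :: (nat \<times> nat, 'a) mpoly) \<or>
    pluecker_form 3 {x,z,y} = - (det_form x z y :: (nat \<times> nat, 'a) mpoly)"
    using * by (auto simp: det_form_swap(1)[of y x] det_form_swap(2)[of x z])
qed (simp add: pluecker_form_sorted)

lemma keys_pluecker_form:
  assumes "x \<noteq> y" "x \<noteq> z" "y \<noteq> z"
  shows "Poly_Mapping.keys (pluecker_form 3 {x,y,z} :: (nat \<times> nat, 'a::field) mpoly) =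
    {row_monomial x y z, row_monomial x z y, row_monomial y x z, row_monomial y z x,
     row_monomial z x y, row_monomial z y x}"
  using pluecker_form_eq_det_form[OF assms, where ?'a = 'a]
proof
  assume "pluecker_form 3 {x,y,z} = - (det_form x y z :: (nat \<times> nat, 'a) mpoly)"
  then have "Poly_Mapping.keys (pluecker_form 3 {x,y,z} :: (nat \<times> nat, 'a) mpoly) =
      Poly_Mapping.keys (det_form x y z :: (nat \<times> nat, 'a) mpoly)"
    by (auto simp: in_keys_iff)
  then show ?thesis using keys_det_form[OF assms] by simp
qed (use keys_det_form[OF assms] in simp)

lemma pluecker_weight_optimal:
  assumes ne: "x \<noteq> y" "x \<noteq> z" "y \<noteq> z" and rows: "{i,j,k} = {1,2,3}" and opt: "optimal M i x j y k z"
  shows "pluecker_weight TYPE('a::field) 3 M {x,y,z} = M i x + M j y + M k z"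
proof -
  let ?w = "\<lambda>(i, j). M i j"
  let ?p = "pluecker_form 3 {x,y,z} :: (nat \<times> nat, 'a) mpoly"
  have wt: "monomial_weight ?w (row_monomial x y z) = M 1 x + M 2 y + M 3 z" for x y z
    by (simp add: monomial_weight_row_monomial)
  have "\<exists>m\<in>Poly_Mapping.keys ?p. monomial_weight ?w m = M i x + M j y + M k z"
    using rows_cases[OF refl rows] unfolding keys_pluecker_form[OF ne]
    by cases (simp_all add: wt)
  then obtain m where m: "m \<in> Poly_Mapping.keys ?p" "monomial_weight ?w m = M i x + M j y + M k z"
    by blast
  have min: "M i x + M j y + M k z \<le> monomial_weight ?w m'" if "m' \<in> Poly_Mapping.keys ?p" for m'
    using that opt unfolding keys_pluecker_form[OF ne] optimal_def
    by (cases rule: rows_cases[OF refl rows]) (auto simp: wt)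
  have "Min (monomial_weight ?w ` Poly_Mapping.keys (initial_form ?w ?p)) = M i x + M j y + M k z"
  proof (rule Min_eqI)
    show "M i x + M j y + M k z \<in> monomial_weight ?w ` Poly_Mapping.keys (initial_form ?w ?p)"
      using m min by (force simp: keys_initial_form)
    fix v assume "v \<in> monomial_weight ?w ` Poly_Mapping.keys (initial_form ?w ?p)"
    then show "M i x + M j y + M k z \<le> v" using min by (auto simp: keys_initial_form)
  qed simp
  then show ?thesis by (simp add: pluecker_weight_def poly_weight_def)
qed

text \<open>The six terms of a determinant have distinct monomials, so the initial form is a single term
  precisely if one matching is strictly cheaper than the other five.\<close>

lemma induces_optimal:
  assumes ind: "induces TYPE('a::field) 3 n M \<Lambda>" and mf: "matching_field 3 n \<Lambda>"
    and xyz: "x < y" "y < z" "x \<in> {1..n}" "z \<in> {1..n}"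
  defines "\<sigma> \<equiv> \<Lambda> {x,y,z}"
  shows "{\<sigma> 1, \<sigma> 2, \<sigma> 3} = {1,2,3}" "optimal M (\<sigma> 1) x (\<sigma> 2) y (\<sigma> 3) z"
proof -
  let ?w = "\<lambda>(i, j). M i j"
  let ?p = "pluecker_form 3 {x,y,z} :: (nat \<times> nat, 'a) mpoly"
  have ne: "x \<noteq> y" "x \<noteq> z" "y \<noteq> z" using xyz by auto
  have I: "{x,y,z} \<in> k_subsets 3 n" using xyz by (auto simp: k_subsets_def)
  have perm: "\<sigma> permutes {1..3}" using mf I by (simp add: matching_field_def \<sigma>_def)
  have 123: "{1..3} = {1,2,3::nat}" by auto
  show rows: "{\<sigma> 1, \<sigma> 2, \<sigma> 3} = {1,2,3}"
    using permutes_image[OF perm] unfolding 123 by simp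
  define m where "m = Poly_Mapping.single (\<sigma> 1, x) (1::nat) + Poly_Mapping.single (\<sigma> 2, y) 1
    + Poly_Mapping.single (\<sigma> 3, z) 1"
  have "initial_form ?w ?p = of_int (sign \<sigma>) * matching_term 3 \<Lambda> {x,y,z}"
    using ind I unfolding induces_def \<sigma>_def by blast
  also have "matching_term 3 \<Lambda> {x,y,z} = (Poly_Mapping.single m 1 :: (nat \<times> nat, 'a) mpoly)"
    unfolding matching_term_def 123 \<sigma>_def[symmetric]
    by (simp add: nth_elem_sorted[OF xyz(1,2)] nth_elem_sorted(1)[OF xyz(1,2), simplified]
      Var_def mult_single m_def add.assoc)
  also have "of_int (sign \<sigma>) * Poly_Mapping.single m 1 = (Poly_Mapping.single m (of_int (sign \<sigma>)) :: (nat \<times> nat, 'a) mpoly)"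
    by (simp add: mult_single flip: single_of_int)
  finally have keys: "Poly_Mapping.keys (initial_form ?w ?p) \<subseteq> {m}" by simp
  have wt: "monomial_weight ?w (row_monomial x y z) = M 1 x + M 2 y + M 3 z" for x y z
    by (simp add: monomial_weight_row_monomial)
  have wm: "monomial_weight ?w m = M (\<sigma> 1) x + M (\<sigma> 2) y + M (\<sigma> 3) z"
    by (simp add: m_def monomial_weight_add monomial_weight_single)
  have fin: "finite (monomial_weight ?w ` Poly_Mapping.keys ?p)"
    "monomial_weight ?w ` Poly_Mapping.keys ?p \<noteq> {}"
    by (simp_all add: keys_pluecker_form[OF ne])
  obtain m0 where m0: "m0 \<in> Poly_Mapping.keys ?p"
    "\<forall>m'\<in>Poly_Mapping.keys ?p. monomial_weight ?w m0 \<le> monomial_weight ?w m'"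
    using Min_in[OF fin] Min_le[OF fin(1)] by force
  then have "m0 = m" using keys by (auto simp: keys_initial_form)
  note m = m0[unfolded this]
  have strict: "monomial_weight ?w m < monomial_weight ?w m'" if "m' \<in> Poly_Mapping.keys ?p" "m' \<noteq> m" for m'
  proof (rule ccontr)
    assume "\<not> monomial_weight ?w m < monomial_weight ?w m'"
    then have "m' \<in> Poly_Mapping.keys (initial_form ?w ?p)"
      using m(2) that(1) by (force simp: keys_initial_form)
    then show False using keys that(2) by blast
  qed
  have m_cases: "(\<sigma> 1 = 1 \<and> \<sigma> 2 = 2 \<and> \<sigma> 3 = 3 \<and> m = row_monomial x y z) \<or>
    (\<sigma> 1 = 1 \<and> \<sigma> 2 = 3 \<and> \<sigma> 3 = 2 \<and> m = row_monomial x z y) \<or>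
    (\<sigma> 1 = 2 \<and> \<sigma> 2 = 1 \<and> \<sigma> 3 = 3 \<and> m = row_monomial y x z) \<or>
    (\<sigma> 1 = 2 \<and> \<sigma> 2 = 3 \<and> \<sigma> 3 = 1 \<and> m = row_monomial z x y) \<or>
    (\<sigma> 1 = 3 \<and> \<sigma> 2 = 1 \<and> \<sigma> 3 = 2 \<and> m = row_monomial y z x) \<or>
    (\<sigma> 1 = 3 \<and> \<sigma> 2 = 2 \<and> \<sigma> 3 = 1 \<and> m = row_monomial z y x)"
    using rows_cases[OF refl rows] unfolding m_def row_monomial_def
    by cases (simp_all add: ac_simps)
  have "\<forall>m'\<in>{row_monomial x y z, row_monomial x z y, row_monomial y x z, row_monomial y z x,
     row_monomial z x y, row_monomial z y x}. m' \<noteq> m \<longrightarrow> monomial_weight ?w m < monomial_weight ?w m'"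
    using strict unfolding keys_pluecker_form[OF ne] by blast
  then show "optimal M (\<sigma> 1) x (\<sigma> 2) y (\<sigma> 3) z"
    using m_cases ne unfolding optimal_def
    by (elim disjE conjE) (simp_all add: row_monomial_inject wt)
qed

text \<open>The matching field records the cheapest matchings, so these agree for two matrices inducing the
  same field. Sorted triples suffice, since optimality does not depend on the order in which the columns
  are listed.\<close>

lemma common_optimum:
  assumes ind: "induces TYPE('a::field) 3 n M \<Lambda>" and mf: "matching_field 3 n \<Lambda>"
    and ind': "induces TYPE('a) 3 k M' (restrict_matching_field \<Lambda> J)"
    and mf': "matching_field 3 k (restrict_matching_field \<Lambda> J)"
    and mono: "strict_mono_on {1..k} (nth_elem J)" "nth_elem J ` {1..k} \<subseteq> {1..n}"
    and ne: "x \<noteq> y" "x \<noteq> z" "y \<noteq> z" and mem: "x \<in> {1..k}" "y \<in> {1..k}" "z \<in> {1..k}"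
  shows "\<exists>i j l. {i,j,l} = {1,2,3} \<and> optimal M' i x j y l z \<and>
    optimal (\<lambda>i c. M i (nth_elem J c)) i x j y l z"
proof -
  let ?N = "\<lambda>i c. M i (nth_elem J c)"
  define common where "common x y z \<longleftrightarrow> x \<in> {1..k} \<and> y \<in> {1..k} \<and> z \<in> {1..k} \<longrightarrow>
    (\<exists>i j l. {i,j,l} = {1,2,3} \<and> optimal M' i x j y l z \<and> optimal ?N i x j y l z)" for x y z
  have "common x y z"
    using ne
  proof (rule wlog_sorted_triple)
    fix x y z assume *: "common x y z"
    show "common y x z" unfolding common_def
    proof
      assume "y \<in> {1..k} \<and> x \<in> {1..k} \<and> z \<in> {1..k}"
      then obtain i j l where ijl: "{i,j,l} = {1,2,3}" "optimal M' i x j y l z" "optimal ?N i x j y l z"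
        using * unfolding common_def by blast
      then have "{j,i,l} = {1,2,3}" by (simp add: insert_commute)
      then show "\<exists>i j l. {i,j,l} = {1,2,3} \<and> optimal M' i y j x l z \<and> optimal ?N i y j x l z"
        using optimal_swap(1)[OF ijl(2)] optimal_swap(1)[OF ijl(3)] by blast
    qed
    show "common x z y" unfolding common_def
    proof
      assume "x \<in> {1..k} \<and> z \<in> {1..k} \<and> y \<in> {1..k}"
      then obtain i j l where ijl: "{i,j,l} = {1,2,3}" "optimal M' i x j y l z" "optimal ?N i x j y l z"
        using * unfolding common_def by blast
      then have "{i,l,j} = {1,2,3}" by (simp add: insert_commute)
      then show "\<exists>i j l. {i,j,l} = {1,2,3} \<and> optimal M' i x j z l y \<and> optimal ?N i x j z l y"
        using optimal_swap(2)[OF ijl(2)] optimal_swap(2)[OF ijl(3)] by blast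
    qed
  next
    fix x y z :: nat assume xyz: "x < y" "y < z"
    show "common x y z" unfolding common_def
    proof
      assume mem: "x \<in> {1..k} \<and> y \<in> {1..k} \<and> z \<in> {1..k}"
      let ?g = "nth_elem J"
      have "?g x < ?g y" "?g y < ?g z"
        using mono(1) xyz mem by (auto simp: strict_mono_on_def)
      moreover have "?g x \<in> {1..n}" "?g z \<in> {1..n}" using mono(2) mem by blast+
      ultimately have g: "?g x < ?g y" "?g y < ?g z" "?g x \<in> {1..n}" "?g z \<in> {1..n}" by blast+
      have eq: "restrict_matching_field \<Lambda> J {x,y,z} = \<Lambda> {?g x, ?g y, ?g z}"
        by (simp add: restrict_matching_field_def)
      let ?\<sigma> = "\<Lambda> {?g x, ?g y, ?g z}"
      have "optimal M' (?\<sigma> 1) x (?\<sigma> 2) y (?\<sigma> 3) z"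
        using induces_optimal(2)[OF ind' mf' xyz] mem unfolding eq by blast
      moreover have "optimal ?N (?\<sigma> 1) x (?\<sigma> 2) y (?\<sigma> 3) z"
        using induces_optimal(2)[OF ind mf g] unfolding optimal_def .
      ultimately show "\<exists>i j l. {i,j,l} = {1,2,3} \<and> optimal M' i x j y l z \<and> optimal ?N i x j y l z"
        using induces_optimal(1)[OF ind mf g] by blast
    qed
  qed
  then show ?thesis using mem unfolding common_def by blast
qed

section \<open>Chambers of arrangements of tropical lines\<close>

text \<open>Homogeneous coordinates with the first one normalised to \<open>0\<close>, so that the three rows of a
  weight matrix can be treated alike.\<close>

definition hcoord :: "nat \<Rightarrow> real \<times> real \<Rightarrow> real" where
  "hcoord i x = (if i = 1 then 0 else if i = 2 then fst x else snd x)"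

text \<open>The open region where row \<open>i\<close> alone attains the maximum that defines the tropical line \<open>j\<close>.\<close>

definition sector :: "(nat \<Rightarrow> nat \<Rightarrow> real) \<Rightarrow> nat \<Rightarrow> nat \<Rightarrow> (real \<times> real) set" where
  "sector M i j = {x. \<forall>k\<in>{1,2,3} - {i}. hcoord k x - M k j < hcoord i x - M i j}"

lemma max_0_not_differentiable: "\<not> (\<lambda>t::real. max 0 t) differentiable (at 0)"
proof
  assume "(\<lambda>t::real. max 0 t) differentiable (at 0)"
  then obtain D where D: "((\<lambda>t::real. max 0 t) has_real_derivative D) (at 0)"
    using real_differentiable_def by blast
  have "((\<lambda>t::real. t) has_real_derivative D) (at 0 within {0..})"
    by (rule has_field_derivative_transform_within[OF has_field_derivative_at_within[OF D], of 1]) auto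
  moreover have "((\<lambda>t::real. t) has_real_derivative 1) (at 0 within {0..})"
    by (auto intro: derivative_eq_intros)
  moreover have "((\<lambda>t::real. 0) has_real_derivative D) (at 0 within {..0})"
    by (rule has_field_derivative_transform_within[OF has_field_derivative_at_within[OF D], of 1]) auto
  moreover have "((\<lambda>t::real. 0) has_real_derivative 0) (at 0 within {..0})"
    by (auto intro: derivative_eq_intros)
  moreover have "at (0::real) within {0..} \<noteq> bot" "at (0::real) within {..0} \<noteq> bot"
    unfolding at_within_Ici_at_right at_within_Iic_at_left
    by (rule trivial_limit_at_right_real trivial_limit_at_left_real)+
  ultimately show False
    by (metis has_field_derivative_unique zero_neq_one)
qed

lemma mem_sector:
  assumes "M 1 j = 0"
  shows "x \<in> sector M 1 j \<longleftrightarrow> fst x - M 2 j < 0 \<and> snd x - M 3 j < 0"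
    and "x \<in> sector M 2 j \<longleftrightarrow> 0 < fst x - M 2 j \<and> snd x - M 3 j < fst x - M 2 j"
    and "x \<in> sector M 3 j \<longleftrightarrow> 0 < snd x - M 3 j \<and> fst x - M 2 j < snd x - M 3 j"
  using assms by (simp_all add: sector_def hcoord_def insert_Diff_if del: One_nat_def)

text \<open>On a sector the maximum is an affine function. Outside the sectors at least two rows attain it,
  and along a coordinate direction it looks like \<open>max 0 t\<close> up to a constant.\<close>

lemma tropical_line_eq_compl_sectors:
  assumes "M 1 j = 0"
  shows "tropical_line M j = - (\<Union>i\<in>{1,2,3}. sector M i j)"
proof -
  note sec = mem_sector[of M, OF assms]
  define f where "f = (\<lambda>(x2, x3). max 0 (max (x2 - M 2 j) (x3 - M 3 j)))"
  have op: "open (sector M i j)" if "i \<in> {1,2,3}" for i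
  proof -
    have "sector M 1 j = {x. fst x - M 2 j < 0} \<inter> {x. snd x - M 3 j < 0}"
      "sector M 2 j = {x. 0 < fst x - M 2 j} \<inter> {x. snd x - M 3 j < fst x - M 2 j}"
      "sector M 3 j = {x. 0 < snd x - M 3 j} \<inter> {x. fst x - M 2 j < snd x - M 3 j}"
      using sec by blast+
    then show ?thesis
      using that by (auto intro!: open_Int open_Collect_less continuous_intros)
  qed
  have diff: "f differentiable (at x)" if x: "x \<in> sector M i j" and i: "i \<in> {1,2,3}" for x i
  proof -
    have "(\<lambda>y. hcoord i y - M i j) differentiable (at x)"
      by (cases "i = 1"; cases "i = 2") (auto simp: hcoord_def bounded_linear_fst bounded_linear_snd
          bounded_linear_imp_differentiable intro!: differentiable_diff)
    then obtain D where D: "((\<lambda>y. hcoord i y - M i j) has_derivative D) (at x)"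
      by (auto simp: differentiable_def)
    have "hcoord i y - M i j = f y" if "y \<in> sector M i j" for y
      
    proof -
      consider "i = 1" | "i = 2" | "i = 3" using i by blast
      then show ?thesis
      proof cases
        case 1
        then have "fst y - M 2 j < 0 \<and> snd y - M 3 j < 0" using that sec(1)[of y] by simp
        then show ?thesis using 1 assms by (simp add: f_def hcoord_def case_prod_beta)
      next
        case 2
        then have "0 < fst y - M 2 j \<and> snd y - M 3 j < fst y - M 2 j" using that sec(2)[of y] by simp
        then show ?thesis using 2 by (simp add: f_def hcoord_def case_prod_beta)
      next
        case 3
        then have "0 < snd y - M 3 j \<and> fst y - M 2 j < snd y - M 3 j" using that sec(3)[of y] by simp
        then show ?thesis using 3 by (simp add: f_def hcoord_def case_prod_beta)
      qed
    qed
    then have "(f has_derivative D) (at x)"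
      by (rule has_derivative_transform_within_open[OF D op[OF i] x])
    then show ?thesis by (auto simp: differentiable_def)
  qed
  have ndiff: "\<not> f differentiable (at x)" if x: "\<forall>i\<in>{1,2,3}. x \<notin> sector M i j" for x
  proof
    assume d: "f differentiable (at x)"
    obtain u v where uv: "x = (u + M 2 j, v + M 3 j)"
      by (metis diff_add_cancel surj_pair)
    have line: "(\<lambda>t. f (x + t *\<^sub>R e)) differentiable (at 0)" for e
    proof -
      have "(\<lambda>t. x + t *\<^sub>R e) differentiable (at 0)"
        by (auto simp: differentiable_def intro!: derivative_eq_intros)
      then show ?thesis
        using d differentiable_chain_at[of "\<lambda>t. x + t *\<^sub>R e" 0 f] by (simp add: o_def)
    qed
    consider "u = 0" "v \<le> 0" | "v = 0" "u \<le> 0" | "u = v" "u \<ge> 0"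
      using x sec[of x] by (auto simp: uv)
    then show False
    proof cases
      case 1
      then have "(\<lambda>t. f (x + t *\<^sub>R (1, 0))) = (\<lambda>t. max 0 t)"
        by (auto simp: f_def uv fun_eq_iff)
      then show False using line[of "(1,0)"] max_0_not_differentiable by simp
    next
      case 2
      then have "(\<lambda>t. f (x + t *\<^sub>R (0, 1))) = (\<lambda>t. max 0 t)"
        by (auto simp: f_def uv fun_eq_iff)
      then show False using line[of "(0,1)"] max_0_not_differentiable by simp
    next
      case 3
      then have "(\<lambda>t. max 0 t) = (\<lambda>t. f (x + t *\<^sub>R (1, 0)) - u)"
        by (auto simp: f_def uv fun_eq_iff)
      moreover have "(\<lambda>t. f (x + t *\<^sub>R (1, 0)) - u) differentiable (at 0)"
        by (intro differentiable_diff line differentiable_const)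
      ultimately show False using max_0_not_differentiable by simp
    qed
  qed
  show ?thesis
    unfolding tropical_line_def f_def[symmetric] using diff ndiff by blast
qed

text \<open>The half-spaces may be redundant; the facets correspond to the members of a minimal subfamily
  with the same intersection.\<close>

lemma card_facets_of_polyhedron_le:
  fixes P :: "'a::euclidean_space set"
  assumes "finite F" and P: "P = \<Inter>F"
    and half: "\<And>h. h \<in> F \<Longrightarrow> \<exists>a b. a \<noteq> 0 \<and> h = {x. a \<bullet> x \<le> b}"
  shows "card {C. C facet_of P} \<le> card F"
proof -
  let ?Q = "\<lambda>G. G \<subseteq> F \<and> P = affine hull P \<inter> \<Inter>G"
  have "?Q F" using P hull_subset[of P affine] by blast
  then obtain G where G: "?Q G" and min: "\<And>G'. ?Q G' \<Longrightarrow> card G \<le> card G'"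
    using ex_has_least_nat[of ?Q F card] by blast
  have finG: "finite G" using G \<open>finite F\<close> finite_subset by blast
  obtain a b where ab: "\<And>h. h \<in> G \<Longrightarrow> a h \<noteq> 0 \<and> h = {x. a h \<bullet> x \<le> b h}"
    using half G by (metis subsetD)
  have psub: "P \<subset> affine hull P \<inter> \<Inter>G'" if "G' \<subset> G" for G'
  proof -
    have "P \<subseteq> affine hull P \<inter> \<Inter>G'" using G that by blast
    moreover have "P \<noteq> affine hull P \<inter> \<Inter>G'"
      using min[of G'] that G psubset_card_mono[OF finG that] by auto
    ultimately show ?thesis by blast
  qed
  have "{C. C facet_of P} = (\<lambda>h. P \<inter> {x. a h \<bullet> x = b h}) ` G"
    using facet_of_polyhedron_explicit[OF finG _ ab psub] G by auto
  then have "card {C. C facet_of P} \<le> card G"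
    using finG by (simp add: card_image_le)
  also have "\<dots> \<le> card F" using G \<open>finite F\<close> by (simp add: card_mono)
  finally show ?thesis .
qed

lemma hcoord_eq_inner: "hcoord i x = (if i = 1 then 0 else if i = 2 then (1, 0) else (0, 1)) \<bullet> x"
  by (cases x) (simp add: hcoord_def)

text \<open>The vector representing the linear functional \<open>x\<^sub>r - x\<^sub>p\<close>.\<close>

definition hcoord_diff :: "nat \<Rightarrow> nat \<Rightarrow> real \<times> real" where
  "hcoord_diff p r = (if r = 1 then 0 else if r = 2 then (1, 0) else (0, 1)) -
     (if p = 1 then 0 else if p = 2 then (1, 0) else (0, 1))"

lemma inner_hcoord_diff: "hcoord_diff p r \<bullet> x = hcoord r x - hcoord p x"
  by (simp only: hcoord_eq_inner hcoord_diff_def inner_diff_left)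

lemma hcoord_diff_nonzero: "p \<in> {1,2,3} \<Longrightarrow> r \<in> {1,2,3} \<Longrightarrow> p \<noteq> r \<Longrightarrow> hcoord_diff p r \<noteq> 0"
  by (auto simp: hcoord_diff_def zero_prod_def)

lemma sector_eq_Int_halfspaces:
  "sector M i j = (\<Inter>k\<in>{1,2,3} - {i}. {x. hcoord_diff i k \<bullet> x < M k j - M i j})"
  unfolding sector_def inner_hcoord_diff by (auto simp: algebra_simps)

lemma open_sector: "open (sector M i j)"
  unfolding sector_eq_Int_halfspaces by (intro open_INT) (auto intro: open_halfspace_lt)

lemma convex_sector: "convex (sector M i j)"
  unfolding sector_eq_Int_halfspaces by (intro convex_INT) (auto intro: convex_halfspace_lt)

lemma sectorD:
  "x \<in> sector M i j \<Longrightarrow> k \<in> {1,2,3} \<Longrightarrow> k \<noteq> i \<Longrightarrow> hcoord k x - M k j < hcoord i x - M i j"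
  unfolding sector_def by blast

lemma disjoint_sectors:
  "i \<in> {1,2,3} \<Longrightarrow> k \<in> {1,2,3} \<Longrightarrow> i \<noteq> k \<Longrightarrow> sector M i j \<inter> sector M k j = {}"
proof -
  assume "i \<in> {1,2,3}" "k \<in> {1,2,3}" "i \<noteq> k"
  then have "\<not> (x \<in> sector M i j \<and> x \<in> sector M k j)" for x
    using sectorD[of x M i j k] sectorD[of x M k j i] by auto
  then show ?thesis by blast
qed

text \<open>Moving by \<open>t\<close> along direction \<open>i\<close> lowers coordinate \<open>i\<close> by \<open>t\<close> relative to the other two. In
  sector \<open>i\<close> this eventually produces a tie; in another sector the lead of the maximal row does not
  decrease.\<close>

lemma ray_meets_tropical_line_iff:
  assumes "M 1 j = 0" and x: "x \<in> sector M k j" and k: "k \<in> {1,2,3}" and i: "i \<in> {1,2,3}"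
  shows "(\<exists>t\<ge>0. x + t *\<^sub>R ray_direction i \<in> tropical_line M j) \<longleftrightarrow> k = i"
proof -
  have trop: "y \<in> tropical_line M j \<longleftrightarrow> y \<notin> sector M 1 j \<and> y \<notin> sector M 2 j \<and> y \<notin> sector M 3 j" for y
    using tropical_line_eq_compl_sectors[of M, OF assms(1)] by auto
  have hc: "hcoord l (x + t *\<^sub>R ray_direction i) - hcoord l' (x + t *\<^sub>R ray_direction i) =
      hcoord l x - hcoord l' x - (if l = i then t else 0) + (if l' = i then t else 0)"
    if "l \<in> {1,2,3}" "l' \<in> {1,2,3}" for l l' t
    using that i by (cases x) (auto simp: hcoord_def ray_direction_def)
  show ?thesis
  proof
    assume "k = i"
    \<comment> \<open>The ray leaves the sector when the runner-up catches up with row \<open>i\<close>.\<close>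
    define gap where "gap l = (hcoord i x - M i j) - (hcoord l x - M l j)" for l
    define t where "t = Min (gap ` ({1,2,3} - {i}))"
    have fin: "finite (gap ` ({1,2,3} - {i}))" "gap ` ({1,2,3} - {i}) \<noteq> {}"
      using i by auto
    have gap: "gap l > 0" if "l \<in> {1,2,3} - {i}" for l
      using sectorD[OF x, of l] that \<open>k = i\<close> by (simp add: gap_def)
    have t: "t > 0" using Min_gr_iff[OF fin] gap unfolding t_def by blast
    obtain l where l: "l \<in> {1,2,3} - {i}" "t = gap l"
      using Min_in[OF fin] unfolding t_def by blast
    have le: "t \<le> gap l'" if "l' \<in> {1,2,3} - {i}" for l'
      unfolding t_def using fin(1) that by (intro Min_le) auto
    let ?y = "x + t *\<^sub>R ray_direction i"
    have "?y \<notin> sector M m j" if m: "m \<in> {1,2,3}" for m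
    proof (cases "m = i")
      case True
      have lmem: "l \<in> {1,2,3}" "l \<noteq> i" using l by auto
      then have "hcoord l ?y - hcoord i ?y = hcoord l x - hcoord i x + t" using hc[of l i t] i by simp
      then have "\<not> hcoord l ?y - M l j < hcoord i ?y - M i j"
        using l(2) unfolding gap_def by linarith
      then show ?thesis using sectorD[OF _ lmem, of ?y M j] True by blast
    next
      case False
      then have "hcoord m ?y - hcoord i ?y = hcoord m x - hcoord i x + t" using hc[of m i t] i m by simp
      then have "\<not> hcoord i ?y - M i j < hcoord m ?y - M m j"
        using le[of m] m False unfolding gap_def by auto
      then show ?thesis using sectorD[OF _ i, of ?y M m j] False by blast
    qed
    then have "?y \<in> tropical_line M j" unfolding trop by auto
    then show "\<exists>t\<ge>0. x + t *\<^sub>R ray_direction i \<in> tropical_line M j"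
      using t less_imp_le by blast
  next
    assume "\<exists>t\<ge>0. x + t *\<^sub>R ray_direction i \<in> tropical_line M j"
    then obtain t where t: "t \<ge> 0" "x + t *\<^sub>R ray_direction i \<in> tropical_line M j" by blast
    show "k = i"
    proof (rule ccontr)
      assume "k \<noteq> i"
      have "x + t *\<^sub>R ray_direction i \<in> sector M k j"
        unfolding sector_def
      proof (intro CollectI ballI)
        fix l assume l: "l \<in> {1,2,3} - {k}"
        then have "hcoord l x - M l j < hcoord k x - M k j"
          using sectorD[OF x, of l] by blast
        then show "hcoord l (x + t *\<^sub>R ray_direction i) - M l j
            < hcoord k (x + t *\<^sub>R ray_direction i) - M k j"
          using hc[of l k t] l k t \<open>k \<noteq> i\<close> by (auto split: if_splits)
      qed
      then show False using t trop k by auto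
    qed
  qed
qed

text \<open>A component of the complement is connected and meets no line, so it lies in a single sector of
  each line; conversely the intersection of these sectors is convex and meets no line, so it lies
  in the component. Since the component is convex and open, it is the interior of its closure, on
  which the covector is defined.\<close>

lemma cell_eq_closure_of_sectors:
  assumes zero: "\<forall>j\<in>{1..n}. M 1 j = 0" and cell: "\<tau> \<in> cells n M"
  obtains s x where "\<And>j. j \<in> {1..n} \<Longrightarrow> s j \<in> {1,2,3}"
    and "\<tau> = closure (\<Inter>j\<in>{1..n}. sector M (s j) j)"
    and "x \<in> (\<Inter>j\<in>{1..n}. sector M (s j) j)"
    and "\<And>i. i \<in> {1,2,3} \<Longrightarrow> covector n M \<tau> i = {j\<in>{1..n}. s j = i}"
proof -
  let ?U = "\<Union>j\<in>{1..n}. tropical_line M j"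
  obtain C where C: "C \<in> components (- ?U)" and \<tau>: "\<tau> = closure C"
    using cell by (auto simp: cells_def)
  obtain x where x: "x \<in> C"
    using C in_components_nonempty by blast
  have sub: "C \<subseteq> - ?U" using C in_components_subset by blast
  have cover: "\<exists>i\<in>{1,2,3}. y \<in> sector M i j" if "y \<in> C" "j \<in> {1..n}" for y j
    using tropical_line_eq_compl_sectors[of M j] zero sub that by blast
  then obtain s where s: "\<And>j. j \<in> {1..n} \<Longrightarrow> s j \<in> {1,2,3} \<and> x \<in> sector M (s j) j"
    using x by metis
  define D where "D = (\<Inter>j\<in>{1..n}. sector M (s j) j)"
  have xD: "x \<in> D" using s by (auto simp: D_def)
  have "convex D" unfolding D_def by (intro convex_INT convex_sector)
  have "open D" unfolding D_def by (intro open_INT) (auto intro: open_sector)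
  have "D \<subseteq> - ?U"
  proof -
    have "sector M (s j) j \<inter> tropical_line M j = {}" if "j \<in> {1..n}" for j
      using tropical_line_eq_compl_sectors[of M j] zero s[OF that] that by blast
    then show ?thesis unfolding D_def by fast
  qed
  then have "D \<subseteq> C"
    using components_maximal[OF C convex_connected[OF \<open>convex D\<close>]] x xD by blast
  moreover have "C \<subseteq> D"
  proof -
    have "C \<subseteq> sector M (s j) j" if j: "j \<in> {1..n}" for j
    proof -
      let ?V = "\<Union>k\<in>{1,2,3} - {s j}. sector M k j"
      have V: "open ?V" by (intro open_UN ballI open_sector)
      have disj: "sector M (s j) j \<inter> ?V \<inter> C = {}"
      proof -
        have "sector M (s j) j \<inter> sector M k j = {}" if k: "k \<in> {1,2,3} - {s j}" for k
          using disjoint_sectors[OF conjunct1[OF s[OF j]] DiffD1[OF k]] k by simp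
        then show ?thesis by blast
      qed
      have cov: "C \<subseteq> sector M (s j) j \<union> ?V"
      proof
        fix y assume "y \<in> C"
        then obtain i where i: "i \<in> {1,2,3}" "y \<in> sector M i j" using cover j by blast
        show "y \<in> sector M (s j) j \<union> ?V"
        proof (cases "i = s j")
          case False
          then have "i \<in> {1,2,3} - {s j}" using i(1) by simp
          then show ?thesis using i(2) by (intro UnI2 UN_I)
        qed (use i(2) in simp)
      qed
      have "sector M (s j) j \<inter> C \<noteq> {}" using conjunct2[OF s[OF j]] x by (metis IntI empty_iff)
      then have "?V \<inter> C = {}"
        using connectedD[OF in_components_connected[OF C] open_sector V disj cov] by simp
      then show ?thesis using cov by blast
    qed
    then show ?thesis unfolding D_def by (rule INT_greatest)
  qed
  ultimately have CD: "C = D" by blast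
  have int: "interior \<tau> = D"
    using convex_interior_closure[OF \<open>convex D\<close>] interior_open[OF \<open>open D\<close>] \<tau> CD by simp
  have "covector n M \<tau> i = {j\<in>{1..n}. s j = i}" if i: "i \<in> {1,2,3}" for i
  proof -
    have "(\<forall>y\<in>D. \<exists>t\<ge>0. y + t *\<^sub>R ray_direction i \<in> tropical_line M j) \<longleftrightarrow> s j = i"
      if j: "j \<in> {1..n}" for j
    proof -
      have "(\<exists>t\<ge>0. y + t *\<^sub>R ray_direction i \<in> tropical_line M j) \<longleftrightarrow> s j = i" if "y \<in> D" for y
        using ray_meets_tropical_line_iff[of M j y "s j" i] zero j i s[OF j] that by (auto simp: D_def)
      then show ?thesis using xD by blast
    qed
    then show ?thesis unfolding covector_def int by blast
  qed
  then show ?thesis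
    using that[of s x] s \<tau> CD xD unfolding D_def by blast
qed

text \<open>The cell is the intersection of the half-planes \<open>x\<^sub>r - x\<^sub>p \<le> \<beta> p r\<close>, with \<open>\<beta> p r\<close> the minimum
  of \<open>M r j - M p j\<close> over the columns \<open>j\<close> in part \<open>p\<close>. If \<open>\<beta> p r \<ge> \<beta> p q + \<beta> q r\<close> held, one of them
  would be implied by two others, and five half-planes bound at most five edges. The potential \<open>u\<close>
  is any point of the open cell.\<close>

lemma hexagonal_cell:
  assumes zero: "\<forall>j\<in>{1..n}. M 1 j = 0" and cell: "\<tau> \<in> cells n M"
    and coarse: "coarse_covector n M \<tau> = (2, 2, 2)" and hex: "hexagon \<tau>"
  obtains s u where "\<And>j. j \<in> {1..n} \<Longrightarrow> s j \<in> {1,2,3}"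
    and "\<And>j k. j \<in> {1..n} \<Longrightarrow> k \<in> {1,2,3} \<Longrightarrow> k \<noteq> s j \<Longrightarrow> M (s j) j - u (s j) < M k j - u k"
    and "\<And>i. i \<in> {1,2,3} \<Longrightarrow> card {j\<in>{1..n}. s j = i} = 2"
    and "\<And>p q r. {p,q,r} = {1,2,3} \<Longrightarrow>
      Min ((\<lambda>j. M r j - M p j) ` {j\<in>{1..n}. s j = p}) <
      Min ((\<lambda>j. M q j - M p j) ` {j\<in>{1..n}. s j = p}) +
      Min ((\<lambda>j. M r j - M q j) ` {j\<in>{1..n}. s j = q})"
proof -
  obtain s x where s: "\<And>j. j \<in> {1..n} \<Longrightarrow> s j \<in> {1,2,3}"
    and \<tau>: "\<tau> = closure (\<Inter>j\<in>{1..n}. sector M (s j) j)"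
    and x: "x \<in> (\<Inter>j\<in>{1..n}. sector M (s j) j)"
    and cov: "\<And>i. i \<in> {1,2,3} \<Longrightarrow> covector n M \<tau> i = {j\<in>{1..n}. s j = i}"
    by (rule cell_eq_closure_of_sectors[OF zero cell], rule that)
  have two: "card {j\<in>{1..n}. s j = i} = 2" if "i \<in> {1,2,3}" for i
    using coarse cov that unfolding coarse_covector_def by auto
  define \<beta> where "\<beta> p r = Min ((\<lambda>j. M r j - M p j) ` {j\<in>{1..n}. s j = p})" for p r
  define E :: "(nat \<times> nat) set" where "E = {(1,2), (1,3), (2,1), (2,3), (3,1), (3,2)}"
  have E: "(p, r) \<in> E \<longleftrightarrow> p \<in> {1,2,3} \<and> r \<in> {1,2,3} \<and> p \<noteq> r" for p r
    by (auto simp: E_def)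
  have E6: "finite E" "card E = 6" by (simp_all add: E_def)
  define H where "H = (\<lambda>(p, r). {y. hcoord_diff p r \<bullet> y \<le> \<beta> p r})"
  define H' where "H' = (\<lambda>(p, r). {y. hcoord_diff p r \<bullet> y < \<beta> p r})"
  have less_\<beta>: "c < \<beta> p r \<longleftrightarrow> (\<forall>j\<in>{1..n}. s j = p \<longrightarrow> c < M r j - M p j)" if "p \<in> {1,2,3}" for c p r
  proof -
    have "{j\<in>{1..n}. s j = p} \<noteq> {}" using two[OF that] by (metis card.empty zero_neq_numeral)
    then show ?thesis unfolding \<beta>_def by (subst Min_gr_iff) auto
  qed
  have D: "(\<Inter>j\<in>{1..n}. sector M (s j) j) = \<Inter>(H' ` E)"
  proof -
    have "y \<in> \<Inter>(H' ` E) \<longleftrightarrow> (\<forall>j\<in>{1..n}. y \<in> sector M (s j) j)" for y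
    proof -
      have "y \<in> \<Inter>(H' ` E) \<longleftrightarrow> (\<forall>p r. (p, r) \<in> E \<longrightarrow> hcoord_diff p r \<bullet> y < \<beta> p r)"
        by (auto simp: H'_def)
      also have "\<dots> \<longleftrightarrow> (\<forall>j\<in>{1..n}. \<forall>k\<in>{1,2,3} - {s j}. hcoord_diff (s j) k \<bullet> y < M k j - M (s j) j)"
      proof (intro iffI ballI allI impI)
        fix j k assume *: "\<forall>p r. (p, r) \<in> E \<longrightarrow> hcoord_diff p r \<bullet> y < \<beta> p r" "j \<in> {1..n}" "k \<in> {1,2,3} - {s j}"
        then have "(s j, k) \<in> E" using s[of j] unfolding E by auto
        then show "hcoord_diff (s j) k \<bullet> y < M k j - M (s j) j"
          using * less_\<beta>[OF s[OF *(2)]] by blast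
      next
        fix p r assume *: "\<forall>j\<in>{1..n}. \<forall>k\<in>{1,2,3} - {s j}. hcoord_diff (s j) k \<bullet> y < M k j - M (s j) j" "(p, r) \<in> E"
        then have pr: "p \<in> {1,2,3}" "r \<in> {1,2,3}" "r \<noteq> p" unfolding E by auto
        show "hcoord_diff p r \<bullet> y < \<beta> p r"
          unfolding less_\<beta>[OF pr(1)] using * pr by auto
      qed
      also have "\<dots> \<longleftrightarrow> (\<forall>j\<in>{1..n}. y \<in> sector M (s j) j)"
        by (auto simp: sector_eq_Int_halfspaces)
      finally show ?thesis .
    qed
    then show ?thesis by blast
  qed
  have \<tau>H: "\<tau> = \<Inter>(H ` E)"
  proof -
    have "closure (\<Inter>(H' ` E)) = \<Inter>(closure ` H' ` E)"
      using x D by (subst closure_Inter_convex_open)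
        (auto simp: H'_def intro: convex_halfspace_lt open_halfspace_lt)
    moreover have "closure (H' e) = H e" if "e \<in> E" for e
      using that hcoord_diff_nonzero E by (cases e) (auto simp: H_def H'_def closure_halfspace_lt)
    ultimately show ?thesis unfolding \<tau> D by (simp add: image_image)
  qed
  have facets: "card {C. C facet_of \<tau>} = 6"
  proof -
    have "C facet_of \<tau> \<longleftrightarrow> C edge_of \<tau>" for C
      using hex by (auto simp: hexagon_def facet_of_def edge_of_def)
    then show ?thesis using hex by (simp add: hexagon_def)
  qed
  have irredundant: "\<beta> p r < \<beta> p q + \<beta> q r" if "{p,q,r} = {1,2,3}" for p q r
  proof (rule ccontr)
    have pqr: "p \<in> {1,2,3}" "q \<in> {1,2,3}" "r \<in> {1,2,3}" using that by blast+
    have ne: "p \<noteq> q" "p \<noteq> r" "q \<noteq> r"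
      using arg_cong[OF that, of card] by (auto simp: card_insert_if split: if_splits)
    have mem: "(p, r) \<in> E" "(p, q) \<in> E - {(p, r)}" "(q, r) \<in> E - {(p, r)}"
      using pqr ne E by auto
    assume "\<not> \<beta> p r < \<beta> p q + \<beta> q r"
    then have "H (p, q) \<inter> H (q, r) \<subseteq> H (p, r)"
      by (auto simp: H_def inner_hcoord_diff)
    then have "\<tau> = \<Inter>(H ` (E - {(p, r)}))"
      unfolding \<tau>H using mem by blast
    then have "card {C. C facet_of \<tau>} \<le> card (H ` (E - {(p, r)}))"
    proof (rule card_facets_of_polyhedron_le[rotated])
      fix h assume "h \<in> H ` (E - {(p, r)})"
      then obtain i k where ik: "(i, k) \<in> E" "h = H (i, k)" by auto
      have "hcoord_diff i k \<noteq> 0" using hcoord_diff_nonzero[of i k] ik(1)[unfolded E] by simp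
      then show "\<exists>a b. a \<noteq> 0 \<and> h = {x. a \<bullet> x \<le> b}"
        unfolding ik(2) H_def prod.case by blast
    qed (use E6 in simp)
    also have "\<dots> \<le> card (E - {(p, r)})" using E6 by (simp add: card_image_le)
    also have "\<dots> = 5" using mem E6 by simp
    finally show False using facets by simp
  qed
  have pot: "M (s j) j - hcoord (s j) x < M k j - hcoord k x"
    if "j \<in> {1..n}" "k \<in> {1,2,3}" "k \<noteq> s j" for j k
  proof -
    have "x \<in> sector M (s j) j" by (rule INT_D[OF x that(1)])
    then show ?thesis using sectorD[OF _ that(2,3), of x M j] by linarith
  qed
  show ?thesis
    by (rule that[of s "\<lambda>k. hcoord k x", OF s pot two irredundant[unfolded \<beta>_def]])
qed

section \<open>Cheapest matchings of a hexagonal arrangement\<close>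

text \<open>The cheapest matchings that a hexagonal arrangement forces, where \<open>s\<close> sends a column to the row
  in whose part of the covector it lies: a transversal triple is matched along \<open>s\<close>, and a part \<open>{g, h}\<close>
  together with a column \<open>y\<close> of another part sends either \<open>g\<close> or \<open>h\<close> to the missing row.\<close>

definition hexagonal_optima :: "(nat \<Rightarrow> nat \<Rightarrow> real) \<Rightarrow> (nat \<Rightarrow> nat) \<Rightarrow> nat set \<Rightarrow> bool" where
  "hexagonal_optima N s C \<longleftrightarrow>
    (\<forall>x\<in>C. \<forall>y\<in>C. \<forall>z\<in>C. {s x, s y, s z} = {1,2,3} \<longrightarrow> optimal N (s x) x (s y) y (s z) z) \<and>
    (\<forall>y\<in>C. \<forall>g\<in>C. \<forall>h\<in>C. \<forall>p q r. g \<noteq> h \<and> s g = p \<and> s h = p \<and> s y = q \<and> {p,q,r} = {1,2,3} \<longrightarrow>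
       optimal N q y p g r h \<or> optimal N q y r g p h)"

text \<open>Let \<open>A\<close> be the matrix of the hexagonal arrangement, and \<open>u\<close> a point of the cell. After subtracting
  the potential \<open>u\<close>, every column is cheapest in its row \<open>s j\<close>, which settles transversal triples.
  For a part \<open>{g, h}\<close> of row \<open>p\<close> and a column \<open>y\<close> of row \<open>q\<close>, a matching that puts \<open>y\<close> into row \<open>p\<close>
  is improved by exchanging \<open>y\<close> with the column in row \<open>q\<close>; one that moves \<open>y\<close> to row \<open>r\<close> must move
  \<open>g\<close> or \<open>h\<close> to row \<open>q\<close>, a detour from \<open>p\<close> to \<open>r\<close>, which is excluded by the strict triangle
  inequality. The assumption \<open>common\<close> carries the conclusion over to \<open>N\<close>.\<close>

lemma hexagonal_optima_if_irredundant:
  assumes C: "finite C" and s: "\<And>j. j \<in> C \<Longrightarrow> s j \<in> {1,2,3}"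
    and pot: "\<And>j k. j \<in> C \<Longrightarrow> k \<in> {1,2,3} \<Longrightarrow> k \<noteq> s j \<Longrightarrow> A (s j) j - u (s j) < A k j - u k"
    and two: "\<And>i. i \<in> {1,2,3} \<Longrightarrow> card {j\<in>C. s j = i} = 2"
    and hex: "\<And>p q r. {p,q,r} = {1,2,3} \<Longrightarrow>
      Min ((\<lambda>j. A r j - A p j) ` {j\<in>C. s j = p}) <
      Min ((\<lambda>j. A q j - A p j) ` {j\<in>C. s j = p}) + Min ((\<lambda>j. A r j - A q j) ` {j\<in>C. s j = q})"
    and common: "\<And>x y z. x \<in> C \<Longrightarrow> y \<in> C \<Longrightarrow> z \<in> C \<Longrightarrow> x \<noteq> y \<Longrightarrow> x \<noteq> z \<Longrightarrow> y \<noteq> z \<Longrightarrow>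
      \<exists>i j k. {i,j,k} = {1,2,3} \<and> optimal A i x j y k z \<and> optimal N i x j y k z"
  shows "hexagonal_optima N s C"
  unfolding hexagonal_optima_def
proof (intro conjI ballI impI allI)
  fix x y z assume xyz: "x \<in> C" "y \<in> C" "z \<in> C" and rows: "{s x, s y, s z} = {1,2,3}"
  note dist = rows_distinct[OF rows]
  then have "x \<noteq> y" "x \<noteq> z" "y \<noteq> z" by auto
  then obtain i j k where ijk: "{i,j,k} = {1,2,3}" "optimal A i x j y k z" "optimal N i x j y k z"
    using common xyz by metis
  have mem: "s x \<in> {1,2,3}" "s y \<in> {1,2,3}" "s z \<in> {1,2,3}" using s xyz by auto
  have less: "A (s x) x - u (s x) < A (s y) x - u (s y)" "A (s x) x - u (s x) < A (s z) x - u (s z)"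
    "A (s y) y - u (s y) < A (s x) y - u (s x)" "A (s y) y - u (s y) < A (s z) y - u (s z)"
    "A (s z) z - u (s z) < A (s x) z - u (s x)" "A (s z) z - u (s z) < A (s y) z - u (s y)"
    using pot[of x] pot[of y] pot[of z] xyz mem dist by metis+
  show "optimal N (s x) x (s y) y (s z) z"
    using rows_cases[OF rows ijk(1)]
  proof cases
    case 1
    then show ?thesis using ijk by simp
  qed (use ijk(2) less in \<open>simp_all add: optimal_def; linarith\<close>)+
next
  fix y g h p q r
  assume ygh: "y \<in> C" "g \<in> C" "h \<in> C"
    and "g \<noteq> h \<and> s g = p \<and> s h = p \<and> s y = q \<and> {p,q,r} = {1,2,3}"
  then have eq: "g \<noteq> h" "s g = p" "s h = p" "s y = q" and rows: "{p,q,r} = {1,2,3}" by auto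
  note dist = rows_distinct[OF rows]
  have mem: "p \<in> {1,2,3}" "q \<in> {1,2,3}" "r \<in> {1,2,3}" using rows by auto
  have "y \<noteq> g" "y \<noteq> h" using eq dist by auto
  then obtain i j k where ijk: "{i,j,k} = {1,2,3}" "optimal A i y j g k h" "optimal N i y j g k h"
    using common[of y g h] ygh eq(1) by metis
  have less: "A p g - u p < A q g - u q" "A p h - u p < A q h - u q" "A q y - u q < A p y - u p"
    using pot[of g q] pot[of h q] pot[of y p] ygh eq mem dist by auto
  have P: "{j\<in>C. s j = p} = {g, h}"
    using card_subset_eq[of "{j\<in>C. s j = p}" "{g, h}"] C two[OF mem(1)] ygh eq by auto
  have "Min ((\<lambda>j. A r j - A q j) ` {j\<in>C. s j = q}) \<le> A r y - A q y"
    using C ygh eq by (intro Min_le) auto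
  \<comment> \<open>The detour through row \<open>q\<close> costs at least the cheapest second leg, and \<open>y\<close> takes such a leg.\<close>
  then have hexy: "min (A r g - A p g) (A r h - A p h) < min (A q g - A p g) (A q h - A p h) + (A r y - A q y)"
    using hex[OF rows] unfolding P by simp
  have "optimal N q y p g r h \<or> optimal N q y r g p h"
    using rows_cases[OF rows ijk(1)]
  proof cases
    case 3
    then show ?thesis using ijk by simp
  next
    case 4
    then show ?thesis using ijk by simp
  next
    case 5
    then show ?thesis using ijk(2) hexy unfolding optimal_def min_def by (auto split: if_splits)
  next
    case 6
    then show ?thesis using ijk(2) hexy unfolding optimal_def min_def by (auto split: if_splits)
  qed (use ijk(2) less in \<open>simp_all add: optimal_def; linarith\<close>)+
  then show "optimal N q y p g r h \<or> optimal N q y r g p h" .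
qed

lemma hexagonal_optimaD:
  assumes "hexagonal_optima N s C" "x \<in> C" "y \<in> C" "z \<in> C"
  shows "{s x, s y, s z} = {1,2,3} \<Longrightarrow> optimal N (s x) x (s y) y (s z) z"
    and "y \<noteq> z \<Longrightarrow> s z = s y \<Longrightarrow> {s y, s x, r} = {1,2,3} \<Longrightarrow>
      optimal N (s x) x (s y) y r z \<or> optimal N (s x) x r y (s y) z"
  using assms unfolding hexagonal_optima_def by auto

lemma three_subset_containing:
  assumes "I \<subseteq> {a,b,c,d,e,f}" "card I = 3" "a \<in> I"
  shows "I \<in> {{a,b,c},{a,b,d},{a,b,e},{a,b,f},{a,c,d},{a,c,e},{a,c,f},{a,d,e},{a,d,f},{a,e,f}}"
proof -
  have "card (I - {a}) = 2" using assms by simp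
  then obtain y z where yz: "I - {a} = {y,z}" "y \<noteq> z" by (auto simp: card_2_iff)
  then have I: "I = {a,y,z}" using assms(3) by blast
  have "y \<in> {b,c,d,e,f}" "z \<in> {b,c,d,e,f}" using yz assms(1) by blast+
  then show ?thesis using yz(2) unfolding I
    by (elim insertE emptyE) (simp_all add: insert_commute)
qed

text \<open>The weights that the algebraic argument needs. With \<open>\<delta> g h i k\<close> the price of moving the cheaper
  one of the columns \<open>g\<close>, \<open>h\<close> from row \<open>i\<close> to row \<open>k\<close>, the weight of a triple exceeds the
  price of placing each column \<open>x\<close> into row \<open>s x\<close> by \<open>0\<close> or by one such \<open>\<delta>\<close>. Hence the sum of the
  weights of two complementary triples is \<open>B\<close> or \<open>B + e i k\<close> for one of the three pairs of rows \<open>i\<close>,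
  \<open>k\<close>, where \<open>B\<close> is the price of placing all six columns according to \<open>s\<close>; the labels are chosen such that \<open>e q r\<close> is the
  largest, and such that \<open>d\<close> and \<open>f\<close> are the columns that move between rows \<open>q\<close> and \<open>r\<close>. The
  strict inequalities hold since the matchings behind the right-hand sides, recombined, give matchings
  of the triples on the left that differ from the optimal ones.\<close>

lemma hexagonal_weight_relations:
  assumes C: "finite C" and s: "\<And>j. j \<in> C \<Longrightarrow> s j \<in> {1,2,3}"
    and two: "\<And>i. i \<in> {1,2,3} \<Longrightarrow> card {j\<in>C. s j = i} = 2"
    and opt: "hexagonal_optima N s C"
    and w: "\<And>i j k x y z. x \<in> C \<Longrightarrow> y \<in> C \<Longrightarrow> z \<in> C \<Longrightarrow> {i,j,k} = {1,2,3} \<Longrightarrow>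
      optimal N i x j y k z \<Longrightarrow> w {x,y,z} = N i x + N j y + N k z"
  obtains a b c d e f where "C = {a,b,c,d,e,f}" "distinct [a,b,c,d,e,f]"
    "w {a,c,e} + w {b,c,d} = w {a,c,d} + w {b,c,e}"
    "w {a,c,d} + w {b,c,e} < w {a,b,c} + w {c,d,e}"
    "w {a,e,f} + w {b,c,e} = w {a,c,e} + w {b,e,f}"
    "w {a,c,e} + w {b,e,f} < w {a,b,e} + w {c,e,f}"
    "\<And>I. I \<subseteq> C \<Longrightarrow> card I = 3 \<Longrightarrow> w I + w (C - I) \<le> w {a,c,d} + w {b,e,f}"
proof -
  define \<delta> where "\<delta> g h i k = min (N k g - N i g) (N k h - N i h)" for g h i k
  have \<delta>_commute: "\<delta> g h i k = \<delta> h g i k" for g h i k by (simp add: \<delta>_def min.commute)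
  have "\<exists>g h. {j\<in>C. s j = i} = {g, h} \<and> g \<noteq> h" if "i \<in> {1,2,3}" for i
    using two[OF that] by (auto simp: card_2_iff)
  then obtain g h where gh: "\<And>i. i \<in> {1,2,3} \<Longrightarrow> {j\<in>C. s j = i} = {g i, h i} \<and> g i \<noteq> h i"
    by metis
  have transversal: "optimal N i x j y k z" "w {x,y,z} = N i x + N j y + N k z"
    if "x \<in> C" "y \<in> C" "z \<in> C" "s x = i" "s y = j" "s z = k" "{i,j,k} = {1,2,3}" for x y z i j k
  proof -
    show *: "optimal N i x j y k z" using hexagonal_optimaD(1)[OF opt that(1-3)] that(4-7) by simp
    show "w {x,y,z} = N i x + N j y + N k z" by (rule w[OF that(1-3,7) *])
  qed
  have pair: "optimal N j y i u k v \<or> optimal N j y k u i v"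
    "w {y,u,v} = N j y + N i u + N i v + \<delta> u v i k"
    if "y \<in> C" "u \<in> C" "v \<in> C" "u \<noteq> v" "s u = i" "s v = i" "s y = j" "{i,j,k} = {1,2,3}"
    for y u v i j k
  proof -
    show *: "optimal N j y i u k v \<or> optimal N j y k u i v"
      using hexagonal_optimaD(2)[OF opt that(1-4), of k] that(5-8) by simp
    have "{j,i,k} = {1,2,3}" "{j,k,i} = {1,2,3}" using that(8) by auto
    then have "optimal N j y i u k v \<and> w {y,u,v} = N j y + N i u + N k v \<or>
       optimal N j y k u i v \<and> w {y,u,v} = N j y + N k u + N i v"
      using * w[OF that(1-3)] by blast
    then show "w {y,u,v} = N j y + N i u + N i v + \<delta> u v i k"
      by (auto simp: optimal_def \<delta>_def min_def)
  qed
  define e where "e i k = \<delta> (g i) (h i) i k + \<delta> (g k) (h k) k i" for i k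
  have e_commute: "e i k = e k i" for i k by (simp add: e_def)
  have "\<exists>p q r. {p,q,r} = {1,2,3} \<and> e p q \<le> e q r \<and> e p r \<le> e q r"
  proof -
    consider "e 1 2 \<le> e 2 3" "e 1 3 \<le> e 2 3" | "e 2 1 \<le> e 1 3" "e 2 3 \<le> e 1 3"
      | "e 3 1 \<le> e 1 2" "e 3 2 \<le> e 1 2"
      using e_commute by (metis linorder_le_cases order_trans)
    moreover have "{1,2,3} = {1,2,3::nat}" "{2,1,3} = {1,2,3::nat}" "{3,1,2} = {1,2,3::nat}" by auto
    ultimately show ?thesis by metis
  qed
  then obtain p q r where rows: "{p,q,r} = {1,2,3}" and max: "e p q \<le> e q r" "e p r \<le> e q r"
    by blast
  have rows': "{p,r,q} = {1,2,3}" "{q,p,r} = {1,2,3}" "{q,r,p} = {1,2,3}" "{r,p,q} = {1,2,3}"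
    "{r,q,p} = {1,2,3}"
    using rows by auto
  have mem: "p \<in> {1,2,3}" "q \<in> {1,2,3}" "r \<in> {1,2,3}" using rows by auto
  define a b where "a = g p" and "b = h p"
  have a: "a \<in> C" "s a = p" and b: "b \<in> C" "s b = p" and "a \<noteq> b"
    using gh[OF mem(1)] unfolding a_def b_def by blast+
  have q: "g q \<in> C" "s (g q) = q" "h q \<in> C" "s (h q) = q" "g q \<noteq> h q"
    using gh[OF mem(2)] by blast+
  have r: "g r \<in> C" "s (g r) = r" "h r \<in> C" "s (h r) = r" "g r \<noteq> h r"
    using gh[OF mem(3)] by blast+
  obtain c d where cd: "{c,d} = {g q, h q}" and acd: "optimal N p a q c r d"
    using pair(1)[of a "g q" "h q" q p r] q a rows' optimal_swap(2) by (metis insert_commute)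
  obtain e' f where ef: "{e',f} = {g r, h r}" and aef: "optimal N p a r e' q f"
    using pair(1)[of a "g r" "h r" r p q] r a rows' optimal_swap(2) by (metis insert_commute)
  have c: "c \<in> C" "s c = q" and d: "d \<in> C" "s d = q" and "c \<noteq> d"
    using cd q by (auto simp: doubleton_eq_iff)
  have e': "e' \<in> C" "s e' = r" and f: "f \<in> C" "s f = r" and "e' \<noteq> f"
    using ef r by (auto simp: doubleton_eq_iff)
  note dist = rows_distinct[OF rows]
  have CC: "C = {a,b,c,d,e',f}"
  proof -
    have "C = (\<Union>i\<in>{1,2,3}. {j\<in>C. s j = i})" using s by blast
    also have "\<dots> = (\<Union>i\<in>{p,q,r}. {g i, h i})" using gh rows by auto
    also have "\<dots> = {a,b,c,d,e',f}" using cd ef unfolding a_def b_def by auto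
    finally show ?thesis .
  qed
  have distinct: "distinct [a,b,c,d,e',f]"
    using a b c d e' f dist \<open>a \<noteq> b\<close> \<open>c \<noteq> d\<close> \<open>e' \<noteq> f\<close> by auto
  have \<delta>s: "\<delta> (g p) (h p) p k = \<delta> a b p k" "\<delta> (g q) (h q) q k = \<delta> c d q k"
    "\<delta> (g r) (h r) r k = \<delta> e' f r k" for k
    using cd ef \<delta>_commute by (auto simp: a_def b_def doubleton_eq_iff)
  note max' = max[unfolded e_def \<delta>s]
  have \<delta>qr: "\<delta> c d q r = N r d - N q d" and \<delta>rq: "\<delta> e' f r q = N q f - N r f"
    using acd aef by (auto simp: optimal_def \<delta>_def min_def)
  have T: "w {x,y,z} = N p x + N q y + N r z"
    if "x \<in> {a,b}" "y \<in> {c,d}" "z \<in> {e',f}" for x y z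
    using transversal(2)[of x y z p q r] that a b c d e' f rows by blast
  have Pq: "w {a,b,y} = N q y + N p a + N p b + \<delta> a b p r" if "y \<in> {c,d}" for y
    using pair(2)[of y a b p q r] that a b c d \<open>a \<noteq> b\<close> rows by (auto simp: insert_commute)
  have Pr: "w {a,b,y} = N r y + N p a + N p b + \<delta> a b p q" if "y \<in> {e',f}" for y
    using pair(2)[of y a b p r q] that a b e' f \<open>a \<noteq> b\<close> rows' by (auto simp: insert_commute)
  have Qp: "w {y,c,d} = N p y + N q c + N q d + \<delta> c d q r" if "y \<in> {a,b}" for y
    using pair(2)[of y c d q p r] that a b c d \<open>c \<noteq> d\<close> rows' by (auto simp: insert_commute)
  have Qr: "w {c,d,y} = N r y + N q c + N q d + \<delta> c d q p" if "y \<in> {e',f}" for y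
    using pair(2)[of y c d q r p] that c d e' f \<open>c \<noteq> d\<close> rows' by (auto simp: insert_commute)
  have Rp: "w {y,e',f} = N p y + N r e' + N r f + \<delta> e' f r q" if "y \<in> {a,b}" for y
    using pair(2)[of y e' f r p q] that a b e' f \<open>e' \<noteq> f\<close> rows' by (auto simp: insert_commute)
  have Rq: "w {y,e',f} = N q y + N r e' + N r f + \<delta> e' f r p" if "y \<in> {c,d}" for y
    using pair(2)[of y e' f r q p] that c d e' f \<open>e' \<noteq> f\<close> rows' by (auto simp: insert_commute)
  have bcd: "optimal N p b q c r d"
    using pair(1)[of b c d q p r] acd b c d \<open>c \<noteq> d\<close> rows' by (auto simp: optimal_def)
  have bef: "optimal N p b r e' q f"
    using pair(1)[of b e' f r p q] aef b e' f \<open>e' \<noteq> f\<close> rows' by (auto simp: optimal_def)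
  have lt1: "w {a,c,d} + w {b,c,e'} < w {a,b,c} + w {c,d,e'}"
    using T[of b c e'] Qp[of a] Pq[of c] Qr[of e'] \<delta>qr acd bcd
    unfolding \<delta>_def optimal_def min_def by (simp split: if_splits)
  have lt2: "w {a,c,e'} + w {b,e',f} < w {a,b,e'} + w {c,e',f}"
    using T[of a c e'] Rp[of b] Pr[of e'] Rq[of c] \<delta>rq aef bef
    unfolding \<delta>_def optimal_def min_def by (simp split: if_splits)
  \<comment> \<open>Exchanging \<open>d\<close> and \<open>f\<close> in the transversal \<open>b\<close>, \<open>d\<close>, \<open>f\<close> cannot lower the price, so
    the products of transversal triples are not heavier than the chosen class.\<close>
  have "optimal N p b q d r f" using transversal(1)[of b d f p q r] b d f rows by blast
  then have nonneg: "\<delta> c d q r + \<delta> e' f r q \<ge> 0"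
    unfolding \<delta>qr \<delta>rq by (auto simp: optimal_def)
  have le: "w I + w (C - I) \<le> w {a,c,d} + w {b,e',f}"
    if I: "I \<subseteq> C" "card I = 3" "a \<in> I" for I
  proof -
    have compl: "C - {a,b,c} = {d,e',f}" "C - {a,b,d} = {c,e',f}" "C - {a,b,e'} = {c,d,f}"
      "C - {a,b,f} = {c,d,e'}" "C - {a,c,d} = {b,e',f}" "C - {a,c,e'} = {b,d,f}"
      "C - {a,c,f} = {b,d,e'}" "C - {a,d,e'} = {b,c,f}" "C - {a,d,f} = {b,c,e'}"
      "C - {a,e',f} = {b,c,d}"
      using distinct unfolding CC by auto
    show ?thesis
      using three_subset_containing[OF I(1)[unfolded CC] I(2,3)] max' nonneg
      by (elim insertE emptyE) (simp_all add: compl T Pq Pr Qp Qr Rp Rq)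
  qed
  have "w I + w (C - I) \<le> w {a,c,d} + w {b,e',f}" if I: "I \<subseteq> C" "card I = 3" for I
  proof (cases "a \<in> I")
    case True
    then show ?thesis using le I by blast
  next
    case False
    have "card C = 6" using distinct unfolding CC by simp
    then have "card (C - I) = 3" using card_Diff_subset[of I C] finite_subset[OF I(1) C] I by simp
    moreover have "C - (C - I) = I" using I by blast
    ultimately show ?thesis using le[of "C - I"] False a by (simp add: add.commute)
  qed
  then show thesis
    using that[OF CC distinct _ lt1 _ lt2] by (simp add: T Qp Rp)
qed

section \<open>Pluecker relations in the initial ideal\<close>

lemma pluecker_form_in_carrier:
  assumes "I \<in> k_subsets 3 n"
  shows "(pluecker_form 3 I :: (nat \<times> nat, 'a::field) mpoly) \<in> carrier (poly_ring ({1..3} \<times> {1..n}))"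
proof -
  obtain x y z where I: "I = {x,y,z}" and ne: "x \<noteq> y" "x \<noteq> z" "y \<noteq> z"
    using assms by (auto simp: k_subsets_def card_3_iff)
  have *: "Poly_Mapping.keys (row_monomial p q r) \<subseteq> {1..3} \<times> {1..n}" if "p \<in> I" "q \<in> I" "r \<in> I" for p q r
  proof -
    have "Poly_Mapping.keys (row_monomial p q r) \<subseteq> {(1,p),(2,q),(3,r)}"
      unfolding row_monomial_def by (intro order_trans[OF Poly_Mapping.keys_add] Un_least) auto
    then show ?thesis using that assms by (auto simp: k_subsets_def)
  qed
  show ?thesis
    using I * unfolding carrier_poly_ring I keys_pluecker_form[OF ne] by simp
qed

lemma ideal_pluecker_ideal: "ideal (pluecker_ideal 3 n :: (nat set, 'a::field) mpoly set) (pluecker_ring 3 n)"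
  unfolding pluecker_ideal_def by (intro ideal_kernel_poly_subst pluecker_form_in_carrier)

lemma mem_pluecker_ideal:
  "p \<in> pluecker_ideal k n \<longleftrightarrow> p \<in> carrier (pluecker_ring k n) \<and> poly_subst (pluecker_form k) p = 0"
  unfolding pluecker_ideal_def a_kernel_def' by simp

text \<open>The Pluecker variable with the sign that makes it map to \<open>det_form x y z\<close>, whatever the order of
  the columns.\<close>

definition bracket :: "nat \<Rightarrow> nat \<Rightarrow> nat \<Rightarrow> (nat set, 'a::field) mpoly" where
  "bracket x y z = (if pluecker_form 3 {x,y,z} = (det_form x y z :: (nat \<times> nat, 'a) mpoly)
     then Var {x,y,z} else - Var {x,y,z})"

lemma poly_subst_bracket:
  assumes "x \<noteq> y" "x \<noteq> z" "y \<noteq> z"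
  shows "poly_subst (pluecker_form 3) (bracket x y z) = (det_form x y z :: (nat \<times> nat, 'a::field) mpoly)"
  using pluecker_form_eq_det_form[OF assms, where ?'a = 'a]
  by (auto simp: bracket_def poly_subst_Var poly_subst_uminus)

lemma keys_bracket: "Poly_Mapping.keys (bracket x y z :: (nat set, 'a::field) mpoly) = {Poly_Mapping.single {x,y,z} 1}"
proof -
  have "Poly_Mapping.keys (- Var v :: (nat set, 'a) mpoly) = Poly_Mapping.keys (Var v :: (nat set, 'a) mpoly)" for v
    by (auto simp: in_keys_iff)
  then show ?thesis by (simp add: bracket_def Var_def)
qed

lemma bracket_in_carrier:
  assumes "{x,y,z} \<subseteq> {1..n}" "x \<noteq> y" "x \<noteq> z" "y \<noteq> z"
  shows "bracket x y z \<in> carrier (pluecker_ring 3 n)"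
  using assms by (auto simp: carrier_poly_ring keys_bracket k_subsets_def)

lemma keys_bracket_mult:
  "Poly_Mapping.keys (bracket x y z * bracket x' y' z' :: (nat set, 'a::field) mpoly) \<subseteq>
    {Poly_Mapping.single {x,y,z} 1 + Poly_Mapping.single {x',y',z'} 1}"
  using keys_mult[of "bracket x y z :: (nat set, 'a) mpoly" "bracket x' y' z'"]
  by (auto simp: keys_bracket)

text \<open>The squarefree multidegree \<open>S\<close> in the grading by columns: \<open>m\<close> uses each column in \<open>S\<close> once
  and no other column.\<close>

definition has_columns :: "nat set \<Rightarrow> (nat set \<Rightarrow>\<^sub>0 nat) \<Rightarrow> bool" where
  "has_columns S m \<longleftrightarrow> (\<forall>j. monomial_weight (\<lambda>I. of_bool (j \<in> I)) m = of_bool (j \<in> S))"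

lemma has_columns_single: "has_columns S (Poly_Mapping.single S 1)"
  by (simp add: has_columns_def monomial_weight_single)

lemma has_columns_add:
  "S \<inter> T = {} \<Longrightarrow> has_columns S m \<Longrightarrow> has_columns T m' \<Longrightarrow> has_columns (S \<union> T) (m + m')"
  by (auto simp: has_columns_def monomial_weight_add)

lemma has_columnsD:
  assumes m: "has_columns S m" and I: "I \<in> Poly_Mapping.keys m"
  shows "I \<subseteq> S" and "I \<noteq> {} \<Longrightarrow> Poly_Mapping.lookup m I = 1"
    and "J \<in> Poly_Mapping.keys m \<Longrightarrow> I \<noteq> J \<Longrightarrow> I \<inter> J = {}"
proof -
  have sum: "(\<Sum>K\<in>Poly_Mapping.keys m. real (Poly_Mapping.lookup m K) * of_bool (j \<in> K)) = of_bool (j \<in> S)" for j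
    using m unfolding has_columns_def monomial_weight_def by simp
  have pos: "real (Poly_Mapping.lookup m K) \<ge> 1" if "K \<in> Poly_Mapping.keys m" for K
    using that by (simp add: in_keys_iff Suc_le_eq)
  have le: "(\<Sum>K\<in>X. real (Poly_Mapping.lookup m K) * of_bool (j \<in> K)) \<le> of_bool (j \<in> S)"
    if "X \<subseteq> Poly_Mapping.keys m" for X j
    unfolding sum[symmetric] using that by (intro sum_mono2) auto
  show "I \<subseteq> S"
  proof
    fix j assume "j \<in> I"
    then show "j \<in> S" using le[of "{I}" j] pos[OF I] I by (cases "j \<in> S") auto
  qed
  show "Poly_Mapping.lookup m I = 1" if nonempty: "I \<noteq> {}"
  proof -
    obtain j where "j \<in> I" using nonempty by blast
    then have "real (Poly_Mapping.lookup m I) \<le> 1" using le[of "{I}" j] I by (cases "j \<in> S") auto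
    then show ?thesis using pos[OF I] by simp
  qed
  show "I \<inter> J = {}" if J: "J \<in> Poly_Mapping.keys m" "I \<noteq> J"
  proof (rule ccontr)
    assume "I \<inter> J \<noteq> {}"
    then obtain j where "j \<in> I" "j \<in> J" by blast
    then show False
      using le[of "{I,J}" j] pos[OF I] pos[OF J(1)] I J by (cases "j \<in> S") auto
  qed
qed

lemma has_columns_covers:
  assumes "has_columns S m" "j \<in> S"
  obtains I where "I \<in> Poly_Mapping.keys m" "j \<in> I"
proof -
  have "(\<Sum>I\<in>Poly_Mapping.keys m. real (Poly_Mapping.lookup m I) * of_bool (j \<in> I)) \<noteq> 0"
    using assms unfolding has_columns_def monomial_weight_def by simp
  then obtain I where "I \<in> Poly_Mapping.keys m" "real (Poly_Mapping.lookup m I) * of_bool (j \<in> I) \<noteq> 0"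
    by (rule sum.not_neutral_contains_not_neutral)
  then show ?thesis using that by simp
qed

lemma has_columns_3:
  assumes "has_columns S m" "Poly_Mapping.keys m \<subseteq> k_subsets 3 n" "card S = 3"
  shows "m = Poly_Mapping.single S 1"
proof -
  have fin: "finite S" using assms(3) by (simp add: card_ge_0_finite)
  have eq: "I = S" if "I \<in> Poly_Mapping.keys m" for I
    using has_columnsD(1)[OF assms(1) that] that assms(2,3) fin
    by (intro card_subset_eq) (auto simp: k_subsets_def)
  obtain j where "j \<in> S" using assms(3) by (metis card.empty ex_in_conv zero_neq_numeral)
  then obtain I where "I \<in> Poly_Mapping.keys m" using has_columns_covers[OF assms(1)] by blast
  then have S: "S \<in> Poly_Mapping.keys m" using eq by blast
  have "Poly_Mapping.lookup m S = 1"
    using has_columnsD(2)[OF assms(1) S] \<open>j \<in> S\<close> by blast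
  then show ?thesis using eq by (intro poly_mapping_eqI) (auto simp: lookup_single when_def in_keys_iff)
qed

text \<open>The variables in \<open>m\<close> have three columns each and partition \<open>S\<close>, so they are two complementary
  triples.\<close>

lemma has_columns_6:
  assumes m: "has_columns S m" "Poly_Mapping.keys m \<subseteq> k_subsets 3 n" "card S = 6"
  obtains I where "I \<subseteq> S" "card I = 3" "m = Poly_Mapping.single I 1 + Poly_Mapping.single (S - I) 1"
proof -
  have fin: "finite S" using assms(3) by (simp add: card_ge_0_finite)
  have 3: "card I = 3" if "I \<in> Poly_Mapping.keys m" for I
    using that m(2) by (auto simp: k_subsets_def)
  obtain j where "j \<in> S" using assms(3) by (metis card.empty ex_in_conv zero_neq_numeral)
  then obtain I where I: "I \<in> Poly_Mapping.keys m" using has_columns_covers[OF m(1)] by blast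
  have IS: "I \<subseteq> S" by (rule has_columnsD(1)[OF m(1) I])
  then have "card (S - I) = 3" using 3[OF I] m(3) fin by (simp add: card_Diff_subset finite_subset)
  then obtain j' where j': "j' \<in> S - I" by (metis card.empty ex_in_conv zero_neq_numeral)
  then obtain J where J: "J \<in> Poly_Mapping.keys m" "j' \<in> J" using has_columns_covers[OF m(1)] by blast
  then have "I \<noteq> J" using j' by blast
  then have "J \<subseteq> S - I"
    using has_columnsD(1)[OF m(1) J(1)] has_columnsD(3)[OF m(1) I J(1)] by blast
  then have JS: "J = S - I"
    using fin \<open>card (S - I) = 3\<close> 3[OF J(1)] by (intro card_subset_eq) auto
  have other: "K = I \<or> K = J" if K: "K \<in> Poly_Mapping.keys m" for K
  proof (rule ccontr)
    assume "\<not> (K = I \<or> K = J)"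
    then have "K \<inter> I = {}" "K \<inter> J = {}"
      using has_columnsD(3)[OF m(1) K I] has_columnsD(3)[OF m(1) K J(1)] by auto
    moreover have "K \<subseteq> S" by (rule has_columnsD(1)[OF m(1) K])
    ultimately have "K = {}" unfolding JS by blast
    then show False using 3[OF K] by simp
  qed
  have one: "Poly_Mapping.lookup m K = 1" if "K \<in> Poly_Mapping.keys m" for K
    using has_columnsD(2)[OF m(1) that] 3[OF that] by fastforce
  have "m = Poly_Mapping.single I 1 + Poly_Mapping.single (S - I) 1"
    unfolding JS[symmetric]
  proof (rule poly_mapping_eqI)
    fix K show "Poly_Mapping.lookup m K = Poly_Mapping.lookup (Poly_Mapping.single I 1 + Poly_Mapping.single J 1) K"
      using other[of K] one[OF I] one[OF J(1)] \<open>I \<noteq> J\<close>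
      by (cases "K \<in> Poly_Mapping.keys m") (auto simp: lookup_add lookup_single when_def in_keys_iff)
  qed
  then show ?thesis using that IS 3[OF I] by blast
qed

lemma column_weight_pluecker_form:
  assumes "I \<in> k_subsets 3 n" "u \<in> Poly_Mapping.keys (pluecker_form 3 I :: (nat \<times> nat, 'a::field) mpoly)"
  shows "monomial_weight (\<lambda>(i, c). of_bool (c = j)) u = (of_bool (j \<in> I) :: real)"
proof -
  obtain x y z where I: "I = {x,y,z}" and ne: "x \<noteq> y" "x \<noteq> z" "y \<noteq> z"
    using assms(1) by (auto simp: k_subsets_def card_3_iff)
  show ?thesis
    using assms(2) ne unfolding I keys_pluecker_form[OF ne]
    by (auto simp: monomial_weight_row_monomial)
qed

text \<open>The Pluecker forms are homogeneous in each column. Hence the coefficients of the image of \<open>F\<close> in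
  column degree \<open>S\<close> come from the component of \<open>F\<close> in that degree alone, and this component is \<open>D\<close>.\<close>

lemma poly_subst_column_component_eq_0:
  fixes F D :: "(nat set, 'a::field) mpoly"
  assumes F: "F \<in> pluecker_ideal 3 n" and D: "D \<in> carrier (pluecker_ring 3 n)"
    and hom: "\<And>m. m \<in> Poly_Mapping.keys D \<Longrightarrow> has_columns S m"
    and agree: "\<And>m. Poly_Mapping.keys m \<subseteq> k_subsets 3 n \<Longrightarrow> has_columns S m \<Longrightarrow>
      Poly_Mapping.lookup F m = Poly_Mapping.lookup D m"
  shows "poly_subst (pluecker_form 3) D = 0"
proof (rule poly_mapping_eqI)
  fix u
  let ?P = "pluecker_form 3 :: nat set \<Rightarrow> (nat \<times> nat, 'a) mpoly"
  let ?xw = "\<lambda>j. \<lambda>(i, c). of_bool (c = j)"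
  have cw: "monomial_weight (?xw j) u = monomial_weight (\<lambda>I. of_bool (j \<in> I)) m"
    if "Poly_Mapping.keys m \<subseteq> k_subsets 3 n" "u \<in> Poly_Mapping.keys (monomial_subst ?P m)" for m j
    using column_weight_pluecker_form that(1)
    by (intro monomial_weight_monomial_subst[OF _ that(2)]) blast
  have keys: "Poly_Mapping.keys m \<subseteq> k_subsets 3 n" if "m \<in> Poly_Mapping.keys F \<union> Poly_Mapping.keys D" for m
    using that F D by (auto simp: mem_pluecker_ideal carrier_poly_ring)
  let ?K = "Poly_Mapping.keys F \<union> Poly_Mapping.keys D"
  have lookup: "Poly_Mapping.lookup (poly_subst ?P G) u =
      (\<Sum>m\<in>?K. Poly_Mapping.lookup G m * Poly_Mapping.lookup (monomial_subst ?P m) u)"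
    if "Poly_Mapping.keys G \<subseteq> ?K" for G
    unfolding lookup_poly_subst using that by (intro sum.mono_neutral_left) (auto simp: in_keys_iff)
  have "Poly_Mapping.lookup (poly_subst ?P D) u = 0"
  proof (cases "\<forall>j. monomial_weight (?xw j) u = (of_bool (j \<in> S) :: real)")
    case True
    have "Poly_Mapping.lookup F m * Poly_Mapping.lookup (monomial_subst ?P m) u =
        Poly_Mapping.lookup D m * Poly_Mapping.lookup (monomial_subst ?P m) u" if m: "m \<in> ?K" for m
    proof (cases "u \<in> Poly_Mapping.keys (monomial_subst ?P m)")
      case u: True
      have "has_columns S m" using cw[OF keys[OF m] u] True by (simp add: has_columns_def)
      then show ?thesis using agree[OF keys[OF m]] by simp
    qed (simp add: in_keys_iff)
    then have "Poly_Mapping.lookup (poly_subst ?P F) u = Poly_Mapping.lookup (poly_subst ?P D) u"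
      unfolding lookup[OF Un_upper1] lookup[OF Un_upper2] by (rule sum.cong[OF refl])
    then show ?thesis using F by (simp add: mem_pluecker_ideal)
  next
    case False
    have "u \<notin> Poly_Mapping.keys (monomial_subst ?P m)" if "m \<in> Poly_Mapping.keys D" for m
      using cw[OF keys, of m] that hom[OF that] False by (auto simp: has_columns_def)
    then show ?thesis by (simp add: lookup_poly_subst in_keys_iff)
  qed
  then show "Poly_Mapping.lookup (poly_subst ?P D) u = Poly_Mapping.lookup 0 u" by simp
qed

lemma poly_subst_det_form:
  "poly_subst g (det_form x y z) =
     g (1,x) * (g (2,y) * g (3,z) - g (2,z) * g (3,y)) - g (1,y) * (g (2,x) * g (3,z) - g (2,z) * g (3,x))
     + g (1,z) * (g (2,x) * g (3,y) - g (2,y) * g (3,x))"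
  by (simp add: det_form_def poly_subst_add poly_subst_diff poly_subst_mult poly_subst_Var)

text \<open>The variable is the only monomial in its column degree, so a lift of it to the Pluecker ideal would make
  the determinant vanish, but the determinant of the identity matrix is \<open>1\<close>.\<close>

lemma bracket_notin_initial_ideal:
  assumes "{x,y,z} \<subseteq> {1..n}" and ne: "x \<noteq> y" "x \<noteq> z" "y \<noteq> z"
  shows "bracket x y z \<notin> (pluecker_initial_ideal 3 n M :: (nat set, 'a::field) mpoly set)"
proof
  let ?w = "pluecker_weight TYPE('a) 3 M"
  let ?b = "bracket x y z :: (nat set, 'a) mpoly"
  assume "?b \<in> pluecker_initial_ideal 3 n M"
  then obtain F where F: "F \<in> pluecker_ideal 3 n" and
    agree: "\<And>m. monomial_weight ?w m = ?w {x,y,z} \<Longrightarrow> Poly_Mapping.lookup F m = Poly_Mapping.lookup ?b m"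
    using initial_ideal_lift[OF ideal_pluecker_ideal] unfolding pluecker_initial_ideal_def by metis
  have "poly_subst (pluecker_form 3) ?b = 0"
  proof (rule poly_subst_column_component_eq_0[OF F, where S = "{x,y,z}"])
    show "?b \<in> carrier (pluecker_ring 3 n)" by (rule bracket_in_carrier[OF assms])
    show "has_columns {x,y,z} m" if "m \<in> Poly_Mapping.keys ?b" for m
      using that has_columns_single by (simp add: keys_bracket)
    show "Poly_Mapping.lookup F m = Poly_Mapping.lookup ?b m"
      if "Poly_Mapping.keys m \<subseteq> k_subsets 3 n" "has_columns {x,y,z} m" for m
    proof (rule agree)
      have "m = Poly_Mapping.single {x,y,z} 1" using has_columns_3[OF that(2,1)] ne by simp
      then show "monomial_weight ?w m = ?w {x,y,z}" by (simp add: monomial_weight_single)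
    qed
  qed
  then have "poly_subst (\<lambda>v. if v \<in> {(1,x),(2,y),(3,z)} then 1 else 0 :: (nat, 'a) mpoly) (det_form x y z) = 0"
    by (simp add: poly_subst_bracket[OF ne] poly_subst_zero)
  then show False using ne by (simp add: poly_subst_det_form)
qed

lemma binomial_in_initial_ideal:
  fixes h t :: "(nat set, 'a::field) mpoly" and M :: "nat \<Rightarrow> nat \<Rightarrow> real"
  defines "w \<equiv> pluecker_weight TYPE('a) 3 M"
  assumes "h + t \<in> pluecker_ideal 3 n"
    and "\<And>m. m \<in> Poly_Mapping.keys h \<Longrightarrow> monomial_weight w m = W"
    and "\<And>m. m \<in> Poly_Mapping.keys t \<Longrightarrow> W < monomial_weight w m"
  shows "h \<in> pluecker_initial_ideal 3 n M"
proof -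
  interpret cring "pluecker_ring 3 n :: (nat set, 'a) mpoly ring" by (rule cring_poly_ring)
  note I = poly_ring_idealD[OF ideal_pluecker_ideal[of n, where ?'a = 'a]]
  have car: "initial_form w ` (pluecker_ideal 3 n :: (nat set, 'a) mpoly set) \<subseteq> carrier (pluecker_ring 3 n)"
  proof (rule image_subsetI)
    fix f :: "(nat set, 'a) mpoly" assume "f \<in> pluecker_ideal 3 n"
    then have "f \<in> carrier (pluecker_ring 3 n)" using I(1) by blast
    then show "initial_form w f \<in> carrier (pluecker_ring 3 n)"
      by (auto simp: carrier_poly_ring keys_initial_form)
  qed
  have eq: "pluecker_initial_ideal 3 n M = Idl\<^bsub>pluecker_ring 3 n\<^esub> (initial_form w ` (pluecker_ideal 3 n :: (nat set, 'a) mpoly set))"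
    unfolding pluecker_initial_ideal_def initial_ideal_def w_def ..
  show ?thesis
  proof (cases "h = 0")
    case True
    then show ?thesis unfolding eq using poly_ring_idealD(2)[OF genideal_ideal[OF car]] by simp
  next
    case False
    have "initial_form w (h + t) = h" by (rule initial_form_add[OF assms(3,4) False])
    then show ?thesis unfolding eq using genideal_self[OF car] assms(2) by (metis imageI subsetD)
  qed
qed

text \<open>The brackets \<open>c a e\<close> and \<open>c b e\<close> occur in the three-term relation for \<open>c\<close> with \<open>a, b, d, e\<close> and
  in the one for \<open>e\<close> with \<open>a, b, c, f\<close>. Eliminating the first from the two initial forms leaves \<open>U * D\<close>
  with the variable \<open>U\<close> outside the ideal. By the maximality assumption every monomial in the
  column degree of \<open>D\<close> is at most as heavy as \<open>D\<close>, so \<open>D\<close> is the whole component of its lift.\<close>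

lemma not_primeideal_pluecker_initial_ideal:
  fixes M :: "nat \<Rightarrow> nat \<Rightarrow> real"
  defines "w \<equiv> pluecker_weight TYPE('a::field) 3 M"
  assumes S: "{a,b,c,d,e,f} \<subseteq> {1..n}" and dist: "distinct [a,b,c,d,e,f]"
    and eq1: "w {a,c,e} + w {b,c,d} = w {a,c,d} + w {b,c,e}"
    and lt1: "w {a,c,d} + w {b,c,e} < w {a,b,c} + w {c,d,e}"
    and eq2: "w {a,e,f} + w {b,c,e} = w {a,c,e} + w {b,e,f}"
    and lt2: "w {a,c,e} + w {b,e,f} < w {a,b,e} + w {c,e,f}"
    and max: "\<And>I. I \<subseteq> {a,b,c,d,e,f} \<Longrightarrow> card I = 3 \<Longrightarrow>
      w I + w ({a,b,c,d,e,f} - I) \<le> w {a,c,d} + w {b,e,f}"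
  shows "\<not> primeideal (pluecker_initial_ideal 3 n M :: (nat set, 'a) mpoly set) (pluecker_ring 3 n)"
proof
  let ?J = "pluecker_initial_ideal 3 n M :: (nat set, 'a) mpoly set"
  let ?R = "pluecker_ring 3 n :: (nat set, 'a) mpoly ring"
  let ?P = "pluecker_form 3 :: nat set \<Rightarrow> (nat \<times> nat, 'a) mpoly"
  assume "primeideal ?J ?R"
  then interpret primeideal ?J ?R .
  note J = poly_ring_idealD[OF is_ideal]
  have ne: "a \<noteq> b" "a \<noteq> c" "a \<noteq> d" "a \<noteq> e" "a \<noteq> f" "b \<noteq> c" "b \<noteq> d" "b \<noteq> e" "b \<noteq> f"
    "c \<noteq> d" "c \<noteq> e" "c \<noteq> f" "d \<noteq> e" "d \<noteq> f" "e \<noteq> f"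
    using dist by auto
  note ne = ne ne[symmetric]
  have mult: "p * q \<in> carrier ?R" if "p \<in> carrier ?R" "q \<in> carrier ?R" for p q
    using m_closed[OF that] by simp
  have add: "p + q \<in> carrier ?R" if "p \<in> carrier ?R" "q \<in> carrier ?R" for p q
    using a_closed[OF that] by simp
  have diff: "p - q \<in> carrier ?R" if "p \<in> carrier ?R" "q \<in> carrier ?R" for p q
    using that minus_closed[of p q] a_inv_poly_ring[of q] by (simp add: a_minus_def)
  define X Y Z U T V :: "(nat set, 'a) mpoly"
    where "X = bracket c a e" and "Y = bracket c b d" and "Z = bracket c a d" and "U = bracket c b e"
      and "T = bracket f b e" and "V = bracket f a e"
  note defs = X_def Y_def Z_def U_def T_def V_def
  have car: "X \<in> carrier ?R" "Y \<in> carrier ?R" "Z \<in> carrier ?R" "U \<in> carrier ?R" "T \<in> carrier ?R"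
    "V \<in> carrier ?R"
    unfolding defs using S ne by (intro bracket_in_carrier; simp)+
  have subst: "poly_subst ?P X = det_form c a e" "poly_subst ?P Y = det_form c b d"
    "poly_subst ?P Z = det_form c a d" "poly_subst ?P U = det_form c b e"
    "poly_subst ?P T = det_form f b e" "poly_subst ?P V = det_form f a e"
    unfolding defs using ne by (intro poly_subst_bracket; simp)+
  have wt: "monomial_weight w m = w {x,y,z} + w {x',y',z'}"
    if "m \<in> Poly_Mapping.keys (bracket x y z * bracket x' y' z' :: (nat set, 'a) mpoly)" for m x y z x' y' z'
    using that keys_bracket_mult[of x y z x' y' z', where ?'a = 'a]
    by (auto simp: monomial_weight_add monomial_weight_single)
  have keys_diff': "m \<in> Poly_Mapping.keys p \<or> m \<in> Poly_Mapping.keys q" if "m \<in> Poly_Mapping.keys (p - q)"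
    for m and p q :: "(nat set, 'a) mpoly"
    using that by (auto simp: in_keys_iff lookup_minus)
  have 1: "X * Y - Z * U \<in> ?J"
  proof (rule binomial_in_initial_ideal)
    have c: "bracket c a b * bracket c d e \<in> carrier ?R"
      using S ne by (intro mult bracket_in_carrier; simp)
    have "X * Y - Z * U + bracket c a b * bracket c d e \<in> carrier ?R"
      by (rule add[OF diff[OF mult[OF car(1,2)] mult[OF car(3,4)]] c])
    moreover have "poly_subst ?P (X * Y - Z * U + bracket c a b * bracket c d e) = 0"
      using ne by (simp add: poly_subst_add poly_subst_diff poly_subst_mult subst poly_subst_bracket)
        (simp add: det_form_def algebra_simps)
    ultimately show "X * Y - Z * U + bracket c a b * bracket c d e \<in> pluecker_ideal 3 n"
      by (simp add: mem_pluecker_ideal)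
    fix m
    show "monomial_weight (pluecker_weight TYPE('a) 3 M) m = w {a,c,d} + w {b,c,e}"
      if "m \<in> Poly_Mapping.keys (X * Y - Z * U)"
      using keys_diff'[OF that] eq1 unfolding w_def[symmetric] defs by (auto dest!: wt simp: insert_commute)
    show "w {a,c,d} + w {b,c,e} < monomial_weight (pluecker_weight TYPE('a) 3 M) m"
      if "m \<in> Poly_Mapping.keys (bracket c a b * bracket c d e :: (nat set, 'a) mpoly)"
      using wt[OF that] lt1 unfolding w_def[symmetric] by (simp add: insert_commute)
  qed
  have 2: "X * T - V * U \<in> ?J"
  proof (rule binomial_in_initial_ideal)
    have c: "bracket f c e * bracket a b e \<in> carrier ?R"
      using S ne by (intro mult bracket_in_carrier; simp)
    have "X * T - V * U + bracket f c e * bracket a b e \<in> carrier ?R"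
      by (rule add[OF diff[OF mult[OF car(1,5)] mult[OF car(6,4)]] c])
    moreover have "poly_subst ?P (X * T - V * U + bracket f c e * bracket a b e) = 0"
      using ne by (simp add: poly_subst_add poly_subst_diff poly_subst_mult subst poly_subst_bracket)
        (simp add: det_form_def algebra_simps)
    ultimately show "X * T - V * U + bracket f c e * bracket a b e \<in> pluecker_ideal 3 n"
      by (simp add: mem_pluecker_ideal)
    fix m
    show "monomial_weight (pluecker_weight TYPE('a) 3 M) m = w {a,c,e} + w {b,e,f}"
      if "m \<in> Poly_Mapping.keys (X * T - V * U)"
      using keys_diff'[OF that] eq2 unfolding w_def[symmetric] defs by (auto dest!: wt simp: insert_commute)
    show "w {a,c,e} + w {b,e,f} < monomial_weight (pluecker_weight TYPE('a) 3 M) m"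
      if "m \<in> Poly_Mapping.keys (bracket f c e * bracket a b e :: (nat set, 'a) mpoly)"
      using wt[OF that] lt2 unfolding w_def[symmetric] by (simp add: insert_commute)
  qed
  define D where "D = Y * V - Z * T"
  have carD: "D \<in> carrier ?R" unfolding D_def using car by (intro diff mult)
  have "T * (X * Y - Z * U) - Y * (X * T - V * U) \<in> ?J"
    by (rule J(6)[OF J(5)[OF 1 car(5)] J(5)[OF 2 car(2)]])
  moreover have "T * (X * Y - Z * U) - Y * (X * T - V * U) = U * D"
    by (simp add: D_def algebra_simps)
  ultimately have "U \<otimes>\<^bsub>?R\<^esub> D \<in> ?J" by simp
  then have "U \<in> ?J \<or> D \<in> ?J" by (rule I_prime[OF car(4) carD])
  moreover have "U \<notin> ?J"
    unfolding U_def using S ne by (intro bracket_notin_initial_ideal) auto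
  ultimately have DJ: "D \<in> ?J" by blast
  define W where "W = w {a,c,d} + w {b,e,f}"
  have wtD: "monomial_weight w m = W" if "m \<in> Poly_Mapping.keys D" for m
    using keys_diff'[OF that[unfolded D_def]] eq1 eq2 unfolding W_def defs
    by (auto dest!: wt simp: insert_commute)
  obtain F where F: "F \<in> pluecker_ideal 3 n" and
    low: "\<And>m. monomial_weight w m < W \<Longrightarrow> Poly_Mapping.lookup F m = 0" and
    top: "\<And>m. monomial_weight w m = W \<Longrightarrow> Poly_Mapping.lookup F m = Poly_Mapping.lookup D m"
    using initial_ideal_lift[OF ideal_pluecker_ideal DJ[unfolded pluecker_initial_ideal_def], of W]
    unfolding w_def by blast
  have "poly_subst ?P D = 0"
  proof (rule poly_subst_column_component_eq_0[OF F carD, where S = "{a,b,c,d,e,f}"])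
    fix m assume "m \<in> Poly_Mapping.keys D"
    then have "m = Poly_Mapping.single {c,b,d} 1 + Poly_Mapping.single {f,a,e} 1 \<or>
        m = Poly_Mapping.single {c,a,d} 1 + Poly_Mapping.single {f,b,e} 1"
      using keys_diff'[of m "Y * V" "Z * T"] keys_bracket_mult[where ?'a = 'a] unfolding D_def defs by blast
    moreover have "{c,b,d} \<union> {f,a,e} = {a,b,c,d,e,f}" "{c,a,d} \<union> {f,b,e} = {a,b,c,d,e,f}" by auto
    ultimately show "has_columns {a,b,c,d,e,f} m"
      using has_columns_add[OF _ has_columns_single has_columns_single, of "{c,b,d}" "{f,a,e}"]
        has_columns_add[OF _ has_columns_single has_columns_single, of "{c,a,d}" "{f,b,e}"] ne
      by auto
  next
    fix m assume m: "Poly_Mapping.keys m \<subseteq> k_subsets 3 n" "has_columns {a,b,c,d,e,f} m"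
    have "card {a,b,c,d,e,f} = 6" using ne by simp
    then obtain I where I: "I \<subseteq> {a,b,c,d,e,f}" "card I = 3"
      "m = Poly_Mapping.single I 1 + Poly_Mapping.single ({a,b,c,d,e,f} - I) 1"
      using has_columns_6[OF m(2,1)] by blast
    then have "monomial_weight w m \<le> W"
      using max[OF I(1,2)] by (simp add: W_def monomial_weight_add monomial_weight_single)
    then show "Poly_Mapping.lookup F m = Poly_Mapping.lookup D m"
      using low[of m] top[of m] wtD[of m] by (cases "monomial_weight w m = W") (auto simp: in_keys_iff)
  qed
  then have "det_form c b d * det_form f a e - det_form c a d * det_form f b e = (0 :: (nat \<times> nat, 'a) mpoly)"
    by (simp add: D_def poly_subst_diff poly_subst_mult subst)
  \<comment> \<open>Substituting unit vectors makes columns \<open>b\<close> and \<open>c\<close> equal, which kills the first product only.\<close>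
  then have "poly_subst (\<lambda>v. if v \<in> {(1,a),(1,e),(2,b),(2,c),(3,d),(3,f)} then 1 else 0 :: (nat, 'a) mpoly)
      (det_form c b d * det_form f a e - det_form c a d * det_form f b e) = 0"
    by (simp add: poly_subst_zero)
  then show False using ne by (simp add: poly_subst_diff poly_subst_mult poly_subst_det_form)
qed


section \<open>Hexagonal restrictions\<close>

lemma nth_elem_strict_mono:
  assumes "finite J"
  shows "strict_mono_on {1..card J} (nth_elem J)" "nth_elem J ` {1..card J} = J"
proof -
  let ?l = "sorted_list_of_set J"
  have len: "length ?l = card J" by simp
  show "strict_mono_on {1..card J} (nth_elem J)"
  proof (rule strict_mono_onI)
    fix r s assume "r \<in> {1..card J}" "s \<in> {1..card J}" "r < s"
    then show "nth_elem J r < nth_elem J s"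
      unfolding nth_elem_def
      using sorted_wrt_nth_less[OF strict_sorted_list_of_set[of J], of "r - 1" "s - 1"] by simp
  qed
  have "nth_elem J ` {1..card J} = (!) ?l ` {0..<card J}"
  proof -
    have "{0..<card J} = (\<lambda>t. t - 1) ` {1..card J}"
    proof (rule Set.set_eqI)
      fix t show "t \<in> {0..<card J} \<longleftrightarrow> t \<in> (\<lambda>t. t - 1) ` {1..card J}"
        by (auto intro!: image_eqI[of _ _ "Suc t"])
    qed
    then show ?thesis by (simp add: image_image nth_elem_def)
  qed
  also have "\<dots> = set ?l" using len by (metis nth_image order_refl take_all_iff atLeast0LessThan)
  finally show "nth_elem J ` {1..card J} = J" using assms by simp
qed

theorem theorem1p1:
  fixes n :: nat and \<Lambda> :: "nat set \<Rightarrow> nat \<Rightarrow> nat" and M :: "nat \<Rightarrow> nat \<Rightarrow> real"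
  assumes "n \<ge> 3"
    and "coherent_matching_field TYPE('k::field) 3 n \<Lambda>"
    and "induces TYPE('k) 3 n M \<Lambda>"
    and "primeideal (pluecker_initial_ideal 3 n M :: (nat set, 'k) mpoly set) (pluecker_ring 3 n)"
    and "binomial_ideal (pluecker_initial_ideal 3 n M :: (nat set, 'k) mpoly set) (pluecker_ring 3 n)"
  shows "non_hexagonal TYPE('k) n \<Lambda>"
  unfolding non_hexagonal_def
proof (intro ballI notI)
  fix J assume J: "J \<in> k_subsets 6 n" and hex: "hexagonal TYPE('k) (restrict_matching_field \<Lambda> J)"
  let ?g = "nth_elem J"
  let ?N = "\<lambda>i c. M i (?g c)"
  let ?w = "pluecker_weight TYPE('k) 3 M"
  have J': "J \<subseteq> {1..n}" "card J = 6" "finite J"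
    using J by (auto simp: k_subsets_def intro: finite_subset)
  have mono: "strict_mono_on {1..6} ?g" and img: "?g ` {1..6} = J"
    using nth_elem_strict_mono[OF J'(3)] unfolding J'(2) by auto
  have inj: "inj_on ?g {1..6}" by (rule strict_mono_on_imp_inj_on[OF mono])
  obtain M' \<tau> where zero: "\<forall>j\<in>{1..6}. M' 1 j = 0"
    and ind': "induces TYPE('k) 3 6 M' (restrict_matching_field \<Lambda> J)"
    and cell: "{\<tau>'\<in>cells 6 M'. coarse_covector 6 M' \<tau>' = (2, 2, 2)} = {\<tau>}" and "hexagon \<tau>"
    using hex unfolding hexagonal_def by blast
  have mf: "matching_field 3 n \<Lambda>" "matching_field 3 6 (restrict_matching_field \<Lambda> J)"
    using assms(2) hex by (simp_all add: coherent_matching_field_def hexagonal_def)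
  have \<tau>: "\<tau> \<in> cells 6 M'" "coarse_covector 6 M' \<tau> = (2, 2, 2)" using cell by blast+
  obtain s u where s: "\<And>j. j \<in> {1..6} \<Longrightarrow> s j \<in> {1,2,3}"
    and pot: "\<And>j k. j \<in> {1..6} \<Longrightarrow> k \<in> {1,2,3} \<Longrightarrow> k \<noteq> s j \<Longrightarrow> M' (s j) j - u (s j) < M' k j - u k"
    and two: "\<And>i. i \<in> {1,2,3} \<Longrightarrow> card {j\<in>{1..6}. s j = i} = 2"
    and irr: "\<And>p q r. {p,q,r} = {1,2,3} \<Longrightarrow>
      Min ((\<lambda>j. M' r j - M' p j) ` {j\<in>{1..6}. s j = p}) <
      Min ((\<lambda>j. M' q j - M' p j) ` {j\<in>{1..6}. s j = p}) +
      Min ((\<lambda>j. M' r j - M' q j) ` {j\<in>{1..6}. s j = q})"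
    by (rule hexagonal_cell[of 6 M' \<tau>, OF zero \<tau> \<open>hexagon \<tau>\<close>], rule that)
  \<comment> \<open>From here on \<open>M'\<close> matters only through its cheapest matchings, which \<open>?N\<close> shares.\<close>
  have opt: "hexagonal_optima ?N s {1..6}"
  proof (rule hexagonal_optima_if_irredundant[of "{1..6}" s M' u, OF _ s pot two irr])
    fix x y z :: nat assume xyz: "x \<in> {1..6}" "y \<in> {1..6}" "z \<in> {1..6}" "x \<noteq> y" "x \<noteq> z" "y \<noteq> z"
    show "\<exists>i j k. {i,j,k} = {1,2,3} \<and> optimal M' i x j y k z \<and> optimal ?N i x j y k z"
      using J'(1) img by (intro common_optimum[OF assms(3) mf(1) ind' mf(2) mono _ xyz(4-6,1-3)]) simp
  qed simp
  have w: "?w (?g ` {x,y,z}) = ?N i x + ?N j y + ?N k z"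
    if xyz: "x \<in> {1..6}" "y \<in> {1..6}" "z \<in> {1..6}" and rows: "{i,j,k} = {1,2,3}"
      and o: "optimal ?N i x j y k z" for x y z i j k
  proof -
    have "x \<noteq> y" "x \<noteq> z" "y \<noteq> z" using o by (auto simp: optimal_def)
    then have "?g x \<noteq> ?g y" "?g x \<noteq> ?g z" "?g y \<noteq> ?g z" using inj xyz by (auto dest: inj_onD)
    moreover have "optimal M i (?g x) j (?g y) k (?g z)" using o unfolding optimal_def .
    ultimately show ?thesis using pluecker_weight_optimal[OF _ _ _ rows, where ?'a = 'k] by simp
  qed
  obtain a b c d e f where C: "{1..6} = {a,b,c,d,e,f}" and dist: "distinct [a,b,c,d,e,f]" and
    rel: "?w (?g ` {a,c,e}) + ?w (?g ` {b,c,d}) = ?w (?g ` {a,c,d}) + ?w (?g ` {b,c,e})"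
    "?w (?g ` {a,c,d}) + ?w (?g ` {b,c,e}) < ?w (?g ` {a,b,c}) + ?w (?g ` {c,d,e})"
    "?w (?g ` {a,e,f}) + ?w (?g ` {b,c,e}) = ?w (?g ` {a,c,e}) + ?w (?g ` {b,e,f})"
    "?w (?g ` {a,c,e}) + ?w (?g ` {b,e,f}) < ?w (?g ` {a,b,e}) + ?w (?g ` {c,e,f})" and
    max: "\<And>I. I \<subseteq> {1..6} \<Longrightarrow> card I = 3 \<Longrightarrow>
      ?w (?g ` I) + ?w (?g ` ({1..6} - I)) \<le> ?w (?g ` {a,c,d}) + ?w (?g ` {b,e,f})"
    by (rule hexagonal_weight_relations[of "{1..6}" s ?N "\<lambda>I. ?w (?g ` I)"],
        simp, erule s, erule two, rule opt, erule (4) w, rule that)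
  have gJ: "{?g a, ?g b, ?g c, ?g d, ?g e, ?g f} = J" using img unfolding C by simp
  have "distinct (map ?g [a,b,c,d,e,f])" using dist inj unfolding C distinct_map by simp
  then have "\<not> primeideal (pluecker_initial_ideal 3 n M :: (nat set, 'k) mpoly set) (pluecker_ring 3 n)"
  proof (intro not_primeideal_pluecker_initial_ideal[of "?g a" "?g b" "?g c" "?g d" "?g e" "?g f"])
    show "{?g a, ?g b, ?g c, ?g d, ?g e, ?g f} \<subseteq> {1..n}" using gJ J'(1) by simp
  next
    fix I assume I: "I \<subseteq> {?g a, ?g b, ?g c, ?g d, ?g e, ?g f}" "card I = 3"
    then obtain I' where I': "I' \<subseteq> {1..6}" "I = ?g ` I'" unfolding gJ by (metis img subset_imageE)
    have "card I' = 3" using I(2) I' card_image[OF inj_on_subset[OF inj I'(1)]] by simp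
    moreover have "?g ` ({1..6} - I') = {?g a, ?g b, ?g c, ?g d, ?g e, ?g f} - I"
      using inj_on_image_set_diff[OF inj _ I'(1), of "{1..6}"] img gJ I'(2) by simp
    ultimately show "?w I + ?w ({?g a, ?g b, ?g c, ?g d, ?g e, ?g f} - I) \<le>
        ?w {?g a, ?g c, ?g d} + ?w {?g b, ?g e, ?g f}"
      using max[OF I'(1)] I'(2) by simp
  qed (use rel in simp_all)
  then show False using assms(4) by blast
qed

end
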